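(* Let $G$ be a second countable locally compact group and let $J_1$ and $J_2$ be ideals of uniqueness of the Fourier algebra $A(G)$. Then $J_1\cap J_2$ is an ideal of uniqueness.
   Context: $C_r^*(G)\subseteq \mathcal{B}(L^2(G))$ is the reduced C*-algebra of $G$ (the operator norm closure of $\lambda(L^1(G))$, where $\lambda$ is the left regular representation with respect to a fixed left Haar measure) and $\mathrm{VN}(G)$ is its weak* closure. The Fourier algebra $A(G)$ consists of the functions $s\mapsto (\lambda_s\xi,\eta)$, $\xi,\eta\in L^2(G)$, and is identified with the predual of $\mathrm{VN}(G)$ via $\langle u,T\rangle=(T\xi,\eta)$ when $u(s)=(\lambda_s\xi,\eta)$. For $J\subseteq A(G)$, $J^{\perp}=\{T\in \mathrm{VN}(G) : \langle u,T\rangle=0 \text{ for all } u\in J\}$. A closed ideal $J$ of $A(G)$ is an ideal of multiplicity if $J^{\perp}\cap C_r^*(G)\neq\{0\}$, and an ideal of uniqueness if $J^{\perp}\cap C_r^*(G)=\{0\}$ (ideals of uniqueness are closed by definition). *)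

theory Defs
  imports "HOL-Analysis.Analysis"
begin

text \<open>
  Groups are written additively, following the library class \<^class>\<open>topological_group_add\<close>;
  commutativity is \<^emph>\<open>not\<close> assumed.  Thus \<open>s + t\<close> is the product of \<open>s\<close> and \<open>t\<close>, and \<open>- s\<close>
  is the inverse of \<open>s\<close>.
\<close>

definition (in topological_group_add) left_haar_measure :: "'a measure \<Rightarrow> bool" where
  "left_haar_measure M \<longleftrightarrow>
     space M = UNIV \<and>
     sets M = sigma_sets UNIV {U. open U} \<and>
     emeasure M UNIV \<noteq> 0 \<and>
     (\<forall>s. \<forall>A\<in>sets M. emeasure M ((+) s ` A) = emeasure M A) \<and>
     (\<forall>K. compact K \<longrightarrow> emeasure M K < \<infinity>) \<and>
     (\<forall>A\<in>sets M. emeasure M A = (INF U\<in>{U. open U \<and> A \<subseteq> U}. emeasure M U)) \<and>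
     (\<forall>U. open U \<longrightarrow> emeasure M U = (SUP K\<in>{K. compact K \<and> K \<subseteq> U}. emeasure M K))"

class locally_compact_group = topological_group_add + t2_space +
  assumes locally_compact: "\<exists>U K. open U \<and> compact K \<and> x \<in> U \<and> U \<subseteq> K"

text \<open>Locally compact Hausdorff groups together with a fixed left Haar measure.\<close>

class haar_group = locally_compact_group +
  fixes haar :: "'a measure"
  assumes left_haar_measure_haar: "left_haar_measure haar"

lemma sets_haar [simp, measurable_cong]: "sets (haar :: 'g::haar_group measure) = sets borel"
  using left_haar_measure_haar[where 'a='g] by (simp add: left_haar_measure_def borel_def)

lemma space_haar [simp]: "space (haar :: 'g::haar_group measure) = UNIV"
  using sets_eq_imp_space_eq[OF sets_haar] by simp

lemma measurable_translation [measurable]: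
  "(\<lambda>t. s + t) \<in> borel_measurable (borel :: 'g::haar_group measure)"
  by (intro borel_measurable_continuous_onI continuous_intros)

lemma distr_haar_translation:
  "distr haar borel (\<lambda>t. s + t) = (haar :: 'g::haar_group measure)"
proof (rule measure_eqI)
  fix A :: "'g set" assume "A \<in> sets (distr haar borel (\<lambda>t. s + t))"
  then have A: "A \<in> sets borel" by simp
  have "(\<lambda>t. s + t) -` A = (+) (- s) ` A"
  proof (intro set_eqI iffI)
    fix x assume "x \<in> (\<lambda>t. s + t) -` A"
    then have "s + x \<in> A" by simp
    moreover have "x = - s + (s + x)" by (simp add: add.assoc[symmetric])
    ultimately show "x \<in> (+) (- s) ` A" by blast
  qed (auto simp: add.assoc[symmetric])
  then show "emeasure (distr haar borel (\<lambda>t. s + t)) A = emeasure haar A"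
    using A left_haar_measure_haar[where 'a='g]
    by (subst emeasure_distr) (auto simp: left_haar_measure_def)
qed simp

definition square_integrable :: "('g::haar_group \<Rightarrow> complex) \<Rightarrow> bool" where
  "square_integrable f \<longleftrightarrow>
     f \<in> borel_measurable haar \<and> integrable haar (\<lambda>x. (cmod (f x))\<^sup>2)"

definition L2_rel :: "('g::haar_group \<Rightarrow> complex) \<Rightarrow> ('g \<Rightarrow> complex) \<Rightarrow> bool" where
  "L2_rel f g \<longleftrightarrow>
     square_integrable f \<and> square_integrable g \<and> (AE x in haar. f x = g x)"

lemma square_integrable_measurable: "square_integrable f \<Longrightarrow> f \<in> borel_measurable borel"
  by (simp add: square_integrable_def measurable_cong_sets[OF sets_haar refl])

lemma square_integrable_mult_cnj:
  assumes "square_integrable f" "square_integrable g"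
  shows "integrable haar (\<lambda>x. f x * cnj (g x))"
proof (rule Bochner_Integration.integrable_bound)
  show "integrable haar (\<lambda>x. (cmod (f x))\<^sup>2 + (cmod (g x))\<^sup>2)"
    using assms by (auto simp: square_integrable_def)
  show "(\<lambda>x. f x * cnj (g x)) \<in> borel_measurable haar"
  proof -
    have [measurable]: "f \<in> borel_measurable borel" "g \<in> borel_measurable borel"
      using assms by (auto intro: square_integrable_measurable)
    have [measurable]: "cnj \<in> borel_measurable borel"
      by (intro borel_measurable_continuous_onI continuous_intros)
    show ?thesis by measurable
  qed
  have "a * b \<le> a\<^sup>2 + b\<^sup>2" for a b :: real
    using sum_squares_bound[of a b] sum_squares_ge_zero[of a b]
    unfolding mult.assoc power2_eq_square by linarith
  then show "AE x in haar. norm (f x * cnj (g x)) \<le> norm ((cmod (f x))\<^sup>2 + (cmod (g x))\<^sup>2)"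
    by (simp add: norm_mult)
qed

lemma square_integrable_zero: "square_integrable (\<lambda>_. 0)"
  by (simp add: square_integrable_def)

lemma square_integrable_add:
  assumes "square_integrable f" "square_integrable g"
  shows "square_integrable (\<lambda>x. f x + g x)"
  unfolding square_integrable_def
proof
  have [measurable]: "f \<in> borel_measurable borel" "g \<in> borel_measurable borel"
    using assms by (auto intro: square_integrable_measurable)
  show "(\<lambda>x. f x + g x) \<in> borel_measurable haar" by measurable
  show "integrable haar (\<lambda>x. (cmod (f x + g x))\<^sup>2)"
  proof (rule Bochner_Integration.integrable_bound)
    show "integrable haar (\<lambda>x. 2 * (cmod (f x))\<^sup>2 + 2 * (cmod (g x))\<^sup>2)"
      using assms by (auto simp: square_integrable_def)
    show "(\<lambda>x. (cmod (f x + g x))\<^sup>2) \<in> borel_measurable haar" by measurable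
    have "(cmod (a + b))\<^sup>2 \<le> 2 * (cmod a)\<^sup>2 + 2 * (cmod b)\<^sup>2" for a b
    proof -
      have "(cmod (a + b))\<^sup>2 \<le> (cmod a + cmod b)\<^sup>2"
        by (intro power_mono norm_triangle_ineq) auto
      also have "\<dots> \<le> 2 * (cmod a)\<^sup>2 + 2 * (cmod b)\<^sup>2"
        using sum_squares_bound[of "cmod a" "cmod b"] by (simp add: power2_sum)
      finally show ?thesis .
    qed
    then show "AE x in haar. norm ((cmod (f x + g x))\<^sup>2)
        \<le> norm (2 * (cmod (f x))\<^sup>2 + 2 * (cmod (g x))\<^sup>2)"
      by simp
  qed
qed

lemma square_integrable_scale:
  assumes "square_integrable f" shows "square_integrable (\<lambda>x. c * f x)"
proof -
  have [measurable]: "f \<in> borel_measurable borel"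
    using assms by (rule square_integrable_measurable)
  show ?thesis
    using assms by (simp add: square_integrable_def norm_mult power_mult_distrib)
qed

lemma square_integrable_translate:
  assumes "square_integrable f" shows "square_integrable (\<lambda>t. f (s + t))"
  unfolding square_integrable_def
proof
  have [measurable]: "f \<in> borel_measurable borel"
    using assms by (rule square_integrable_measurable)
  show "(\<lambda>t. f (s + t)) \<in> borel_measurable haar" by measurable
  show "integrable haar (\<lambda>t. (cmod (f (s + t)))\<^sup>2)"
    using assms integrable_distr_eq[of "\<lambda>t. s + t" haar borel "\<lambda>t. (cmod (f t))\<^sup>2"]
    unfolding distr_haar_translation by (simp add: square_integrable_def)
qed

lemma AE_haar_translate:
  assumes "AE x in (haar :: 'g::haar_group measure). P x" shows "AE x in haar. P (s + x)"
proof (rule AE_distrD[where M = haar and M' = borel and f = "\<lambda>t. s + t"])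
  show "(\<lambda>t. s + t) \<in> measurable haar borel" by measurable
  show "AE x in distr haar borel (\<lambda>t. s + t). P x"
    unfolding distr_haar_translation by (rule assms)
qed

quotient_type (overloaded) 'g L2 = "'g::haar_group \<Rightarrow> complex" / partial: L2_rel
proof (rule part_equivpI)
  show "\<exists>f. L2_rel f f"
    by (rule exI[of _ "\<lambda>_. 0"]) (simp add: L2_rel_def square_integrable_zero)
  show "symp L2_rel"
    by (auto simp: symp_def L2_rel_def eq_commute)
  show "transp L2_rel"
    unfolding transp_def L2_rel_def by (auto elim: AE_mp)
qed

lift_definition cinner :: "'g::haar_group L2 \<Rightarrow> 'g L2 \<Rightarrow> complex"
  is "\<lambda>f g. LINT x|haar. f x * cnj (g x)"
proof -
  fix f f' g g' :: "'g \<Rightarrow> complex"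
  assume *: "L2_rel f f'" "L2_rel g g'"
  show "(LINT x|haar. f x * cnj (g x)) = (LINT x|haar. f' x * cnj (g' x))"
  proof (rule integral_cong_AE)
    show "AE x in haar. f x * cnj (g x) = f' x * cnj (g' x)"
      using * unfolding L2_rel_def by (auto elim: AE_mp)
  qed (use * in \<open>auto simp: L2_rel_def intro!: borel_measurable_integrable square_integrable_mult_cnj\<close>)
qed

lift_definition scaleC :: "complex \<Rightarrow> 'g::haar_group L2 \<Rightarrow> 'g L2"
  is "\<lambda>c f x. c * f x"
  by (auto simp: L2_rel_def square_integrable_scale)

instantiation L2 :: (haar_group) real_inner
begin

lift_definition zero_L2 :: "'a L2" is "\<lambda>_. 0"
  by (simp add: L2_rel_def square_integrable_zero)

lift_definition plus_L2 :: "'a L2 \<Rightarrow> 'a L2 \<Rightarrow> 'a L2" is "\<lambda>f g x. f x + g x"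
  unfolding L2_rel_def by (auto intro: square_integrable_add)

definition uminus_L2 :: "'a L2 \<Rightarrow> 'a L2" where "- x = scaleC (- 1) x"
definition minus_L2 :: "'a L2 \<Rightarrow> 'a L2 \<Rightarrow> 'a L2" where "x - y = x + - (y :: 'a L2)"
definition scaleR_L2 :: "real \<Rightarrow> 'a L2 \<Rightarrow> 'a L2" where "r *\<^sub>R x = scaleC (complex_of_real r) x"
definition inner_L2 :: "'a L2 \<Rightarrow> 'a L2 \<Rightarrow> real" where "x \<bullet> y = Re (cinner x y)"
definition norm_L2 :: "'a L2 \<Rightarrow> real" where "norm x = sqrt (x \<bullet> (x :: 'a L2))"
definition dist_L2 :: "'a L2 \<Rightarrow> 'a L2 \<Rightarrow> real" where "dist x y = norm (x - y :: 'a L2)"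
definition sgn_L2 :: "'a L2 \<Rightarrow> 'a L2" where "sgn x = inverse (norm x) *\<^sub>R (x :: 'a L2)"
definition uniformity_L2 :: "('a L2 \<times> 'a L2) filter" where
  "uniformity = (INF e\<in>{0 <..}. principal {(x, y :: 'a L2). dist x y < e})"
definition open_L2 :: "'a L2 set \<Rightarrow> bool" where
  "open U \<longleftrightarrow> (\<forall>x\<in>U. eventually (\<lambda>(x', y). x' = x \<longrightarrow> y \<in> U) (uniformity :: ('a L2 \<times> 'a L2) filter))"

instance
proof
  fix x y z :: "'a L2" and a b :: real and U :: "'a L2 set"
  show "x + y + z = x + (y + z)"
    by transfer (auto simp: L2_rel_def add.assoc intro!: square_integrable_add)
  show "x + y = y + x"
    by transfer (auto simp: L2_rel_def add.commute intro!: square_integrable_add)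
  show "0 + x = x" by transfer (auto simp: L2_rel_def)
  show "- x + x = 0"
    unfolding uminus_L2_def by transfer (auto simp: L2_rel_def square_integrable_zero)
  show "x - y = x + - y" by (rule minus_L2_def)
  show "a *\<^sub>R (x + y) = a *\<^sub>R x + a *\<^sub>R y"
    unfolding scaleR_L2_def
    by transfer (auto simp: L2_rel_def distrib_left intro!: square_integrable_add square_integrable_scale)
  show "(a + b) *\<^sub>R x = a *\<^sub>R x + b *\<^sub>R x"
    unfolding scaleR_L2_def
    by transfer (auto simp: L2_rel_def distrib_right intro!: square_integrable_add square_integrable_scale)
  show "a *\<^sub>R b *\<^sub>R x = (a * b) *\<^sub>R x"
    unfolding scaleR_L2_def
    by transfer (auto simp: L2_rel_def mult.assoc intro!: square_integrable_scale)
  show "1 *\<^sub>R x = x"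
    unfolding scaleR_L2_def by transfer (auto simp: L2_rel_def)
  show "dist x y = norm (x - y)" by (rule dist_L2_def)
  show "sgn x = inverse (norm x) *\<^sub>R x" by (rule sgn_L2_def)
  show "uniformity = (INF e\<in>{0 <..}. principal {(x, y :: 'a L2). dist x y < e})"
    by (rule uniformity_L2_def)
  show "open U \<longleftrightarrow> (\<forall>x\<in>U. \<forall>\<^sub>F (x', y) in uniformity. x' = x \<longrightarrow> y \<in> U)"
    by (rule open_L2_def)
  show "norm x = sqrt (x \<bullet> x)" by (rule norm_L2_def)
  have "cinner x y = cnj (cinner y x)"
  proof transfer
    fix f g :: "'a \<Rightarrow> complex" assume "L2_rel f f" "L2_rel g g"
    show "(LINT t|haar. f t * cnj (g t)) = cnj (LINT t|haar. g t * cnj (f t))"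
      by (subst Bochner_Integration.integral_cnj[symmetric]) (simp add: mult.commute)
  qed
  then show "x \<bullet> y = y \<bullet> x" by (simp add: inner_L2_def)
  have "cinner (x + y) z = cinner x z + cinner y z"
    by transfer (auto simp: L2_rel_def distrib_right square_integrable_mult_cnj)
  then show "(x + y) \<bullet> z = x \<bullet> z + y \<bullet> z" by (simp add: inner_L2_def)
  have "cinner (scaleC c x) y = c * cinner x y" for c
    by transfer (simp add: mult.assoc)
  then show "(a *\<^sub>R x) \<bullet> y = a * (x \<bullet> y)" by (simp add: inner_L2_def scaleR_L2_def)
  have self: "(LINT t|haar. f t * cnj (f t)) = complex_of_real (LINT t|haar. (cmod (f t))\<^sup>2)"
    for f :: "'a \<Rightarrow> complex"
    by (simp add: complex_norm_square[symmetric] flip: integral_complex_of_real)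
  show "0 \<le> x \<bullet> x"
    unfolding inner_L2_def by transfer (simp add: self)
  show "x \<bullet> x = 0 \<longleftrightarrow> x = 0"
    unfolding inner_L2_def
  proof transfer
    fix f :: "'a \<Rightarrow> complex" assume "L2_rel f f"
    then have f: "square_integrable f" by (simp add: L2_rel_def)
    have "Re (LINT t|haar. f t * cnj (f t)) = 0 \<longleftrightarrow> (AE t in haar. (cmod (f t))\<^sup>2 = 0)"
      using f unfolding self
      by (subst integral_nonneg_eq_0_iff_AE[symmetric]) (auto simp: square_integrable_def)
    then show "Re (LINT t|haar. f t * cnj (f t)) = 0 \<longleftrightarrow> L2_rel f (\<lambda>_. 0)"
      using f by (simp add: L2_rel_def square_integrable_zero)
  qed
qed

end

text \<open>The left regular representation: \<open>(\<lambda>\<^sub>s \<xi>)(t) = \<xi>(s\<^sup>-\<^sup>1 t)\<close>.\<close>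

lift_definition left_regular :: "'g::haar_group \<Rightarrow> 'g L2 \<Rightarrow> 'g L2"
  is "\<lambda>s f t. f (- s + t)"
  unfolding L2_rel_def using square_integrable_translate AE_haar_translate by blast

text \<open>
  The type \<open>'g L2 \<Rightarrow>\<^sub>L 'g L2\<close> consists of the bounded \<^emph>\<open>real\<close>-linear operators; the
  algebra \<open>B(L\<^sup>2(G))\<close> is its subset of complex-linear operators, with the same norm.
\<close>

definition bounded_ops :: "('g::haar_group L2 \<Rightarrow>\<^sub>L 'g L2) set" where
  "bounded_ops = {T. \<forall>c x. blinfun_apply T (scaleC c x) = scaleC c (blinfun_apply T x)}"

text \<open>For \<open>f \<in> L\<^sup>1(G)\<close>, the operator \<open>\<lambda>(f) = \<integral> f(s) \<lambda>\<^sub>s ds\<close> (weak integral).\<close>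

definition left_regular_L1 :: "('g::haar_group \<Rightarrow> complex) \<Rightarrow> ('g L2 \<Rightarrow>\<^sub>L 'g L2)" where
  "left_regular_L1 f = (THE T. T \<in> bounded_ops \<and>
     (\<forall>\<xi> \<eta>. cinner (blinfun_apply T \<xi>) \<eta> = (LINT s|haar. f s * cinner (left_regular s \<xi>) \<eta>)))"

definition reduced_Cstar :: "('g::haar_group L2 \<Rightarrow>\<^sub>L 'g L2) set" where
  "reduced_Cstar = closure (left_regular_L1 ` {f. integrable haar f})"

text \<open>
  The weak* topology of \<open>B(L\<^sup>2(G))\<close> as the dual of the trace class operators, whose elements
  act as \<open>T \<mapsto> \<Sum>n. (T \<xi>\<^sub>n, \<eta>\<^sub>n)\<close> with \<open>\<Sum>n. \<parallel>\<xi>\<^sub>n\<parallel>\<^sup>2 < \<infinity>\<close> and \<open>\<Sum>n. \<parallel>\<eta>\<^sub>n\<parallel>\<^sup>2 < \<infinity>\<close>.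
\<close>

definition weak_star_topology :: "('g::haar_group L2 \<Rightarrow>\<^sub>L 'g L2) topology" where
  "weak_star_topology = topology_generated_by
     {{T \<in> bounded_ops. (\<Sum>n. cinner (blinfun_apply T (\<xi> n)) (\<eta> n)) \<in> U} | \<xi> \<eta> U.
        summable (\<lambda>n::nat. (norm (\<xi> n))\<^sup>2) \<and> summable (\<lambda>n::nat. (norm (\<eta> n))\<^sup>2) \<and> open U}"

definition VN :: "('g::haar_group L2 \<Rightarrow>\<^sub>L 'g L2) set" where
  "VN = weak_star_topology closure_of reduced_Cstar"

definition coefficient :: "'g::haar_group L2 \<Rightarrow> 'g L2 \<Rightarrow> 'g \<Rightarrow> complex" where
  "coefficient \<xi> \<eta> = (\<lambda>s. cinner (left_regular s \<xi>) \<eta>)"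

definition fourier_algebra :: "('g::haar_group \<Rightarrow> complex) set" where
  "fourier_algebra = {coefficient \<xi> \<eta> | \<xi> \<eta>. True}"

text \<open>For \<open>u \<in> A(G)\<close> and \<open>T \<in> VN(G)\<close> the value does not depend on the choice of \<open>\<xi>, \<eta>\<close>.\<close>

definition pairing :: "('g::haar_group \<Rightarrow> complex) \<Rightarrow> ('g L2 \<Rightarrow>\<^sub>L 'g L2) \<Rightarrow> complex" where
  "pairing u T = (THE c. \<forall>\<xi> \<eta>. u = coefficient \<xi> \<eta> \<longrightarrow> c = cinner (blinfun_apply T \<xi>) \<eta>)"

text \<open>The norm of \<open>A(G)\<close> as the predual of \<open>VN(G)\<close>.\<close>

definition fourier_norm :: "('g::haar_group \<Rightarrow> complex) \<Rightarrow> real" where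
  "fourier_norm u = (SUP T\<in>{T \<in> VN. norm T \<le> 1}. cmod (pairing u T))"

definition fourier_ideal :: "('g::haar_group \<Rightarrow> complex) set \<Rightarrow> bool" where
  "fourier_ideal J \<longleftrightarrow>
     J \<subseteq> fourier_algebra \<and>
     (\<lambda>_. 0) \<in> J \<and>
     (\<forall>u\<in>J. \<forall>v\<in>J. (\<lambda>s. u s + v s) \<in> J) \<and>
     (\<forall>c. \<forall>u\<in>J. (\<lambda>s. c * u s) \<in> J) \<and>
     (\<forall>u\<in>fourier_algebra. \<forall>v\<in>J. (\<lambda>s. u s * v s) \<in> J)"

definition fourier_closed :: "('g::haar_group \<Rightarrow> complex) set \<Rightarrow> bool" where
  "fourier_closed J \<longleftrightarrow>
     (\<forall>u\<in>fourier_algebra. (\<forall>\<epsilon>>0. \<exists>v\<in>J. fourier_norm (\<lambda>s. u s - v s) < \<epsilon>) \<longrightarrow> u \<in> J)"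

definition annihilator :: "('g::haar_group \<Rightarrow> complex) set \<Rightarrow> ('g L2 \<Rightarrow>\<^sub>L 'g L2) set" where
  "annihilator J = {T \<in> VN. \<forall>u\<in>J. pairing u T = 0}"

definition ideal_of_uniqueness :: "('g::haar_group \<Rightarrow> complex) set \<Rightarrow> bool" where
  "ideal_of_uniqueness J \<longleftrightarrow>
     fourier_ideal J \<and> fourier_closed J \<and> annihilator J \<inter> reduced_Cstar = {0}"

end

theory Submission
  imports Defs
begin

text \<open>
  Let \<open>T \<in> C\<^sub>r\<^sup>*(G)\<close> annihilate \<open>J\<^sub>1 \<inter> J\<^sub>2\<close>.  The algebra \<open>C\<^sub>r\<^sup>*(G)\<close> is a module over \<open>A(G)\<close> with
  \<open>\<langle>v, u \<cdot> T\<rangle> = \<langle>uv, T\<rangle>\<close>; on \<open>\<lambda>(L\<^sup>1(G))\<close> the action is \<open>u \<cdot> \<lambda>(f) = \<lambda>(uf)\<close>, and it is bounded by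
  Fell's absorption principle.  For \<open>u \<in> J\<^sub>1\<close> the operator \<open>u \<cdot> T\<close> annihilates \<open>J\<^sub>2\<close>, because
  \<open>J\<^sub>1 J\<^sub>2 \<subseteq> J\<^sub>1 \<inter> J\<^sub>2\<close>, and hence vanishes.  So for every \<open>v \<in> A(G)\<close> the operator \<open>v \<cdot> T\<close> annihilates
  \<open>J\<^sub>1\<close> and vanishes too.  A coefficient \<open>u\<close> of two compactly supported vectors satisfies \<open>u = vu\<close> for
  some \<open>v \<in> A(G)\<close> equal to 1 on the support of \<open>u\<close>, so \<open>\<langle>u, T\<rangle> = \<langle>u, v \<cdot> T\<rangle> = 0\<close>, and \<open>T = 0\<close> by density.
\<close>

section \<open>The Hilbert space L2(G)\<close>

lemma L2_rel_refl: "square_integrable f \<Longrightarrow> L2_rel f f"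
  by (simp add: L2_rel_def)

lemma L2_cases:
  obtains f where "square_integrable f" "\<xi> = abs_L2 f"
proof -
  have "\<exists>f. square_integrable f \<and> \<xi> = abs_L2 f"
    by (rule L2.abs_induct) (auto simp: L2_rel_def)
  then show ?thesis using that by blast
qed

lemma cinner_abs:
  assumes "square_integrable f" "square_integrable g"
  shows "cinner (abs_L2 f) (abs_L2 g) = (LINT x|haar. f x * cnj (g x))"
  using assms by (intro cinner.abs_eq L2_rel_refl)

lemma left_regular_abs:
  assumes "square_integrable f"
  shows "left_regular s (abs_L2 f) = abs_L2 (\<lambda>t. f (- s + t))"
  using assms by (intro left_regular.abs_eq L2_rel_refl)

lemma plus_abs:
  assumes "square_integrable f" "square_integrable g"
  shows "abs_L2 f + abs_L2 g = abs_L2 (\<lambda>x. f x + g x)"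
  using assms by (intro plus_L2.abs_eq L2_rel_refl)

lemma scaleC_abs:
  assumes "square_integrable f"
  shows "scaleC c (abs_L2 f) = abs_L2 (\<lambda>x. c * f x)"
  using assms by (intro scaleC.abs_eq L2_rel_refl)

lemma square_integrable_diff:
  assumes "square_integrable f" "square_integrable g"
  shows "square_integrable (\<lambda>x. f x - g x)"
  using square_integrable_add[OF assms(1) square_integrable_scale[OF assms(2), of "- 1"]] by simp

lemma minus_abs:
  assumes "square_integrable f" "square_integrable g"
  shows "abs_L2 f - abs_L2 g = abs_L2 (\<lambda>x. f x - g x)"
  using plus_abs[OF assms(1) square_integrable_scale[OF assms(2), of "- 1"]]
  by (simp add: minus_L2_def uminus_L2_def scaleC_abs assms)

lemma norm_abs_L2:
  assumes "square_integrable f"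
  shows "(norm (abs_L2 f))\<^sup>2 = (LINT x|haar. (cmod (f x))\<^sup>2)"
proof -
  have "(LINT t|haar. f t * cnj (f t)) = complex_of_real (LINT t|haar. (cmod (f t))\<^sup>2)"
    by (simp add: complex_norm_square[symmetric] flip: integral_complex_of_real)
  then show ?thesis
    unfolding power2_norm_eq_inner inner_L2_def cinner_abs[OF assms assms] by simp
qed

section \<open>The complex inner product and its norm\<close>

lemma cinner_commute: "cinner x y = cnj (cinner y x)"
proof transfer
  fix f g :: "'a \<Rightarrow> complex"
  show "(LINT t|haar. f t * cnj (g t)) = cnj (LINT t|haar. g t * cnj (f t))"
    by (subst Bochner_Integration.integral_cnj[symmetric]) (simp add: mult.commute)
qed

lemma cinner_add_left: "cinner (x + y) z = cinner x z + cinner y z"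
  by transfer (auto simp: L2_rel_def distrib_right square_integrable_mult_cnj)

lemma cinner_scaleC_left [simp]: "cinner (scaleC c x) y = c * cinner x y"
  by transfer (simp add: mult.assoc)

lemma cinner_add_right: "cinner z (x + y) = cinner z x + cinner z y"
  by (subst (1 2 3) cinner_commute) (simp add: cinner_add_left)

lemma cinner_scaleC_right [simp]: "cinner x (scaleC c y) = cnj c * cinner x y"
  by (subst (1 2) cinner_commute) simp

lemma cinner_scaleR_left [simp]: "cinner (r *\<^sub>R x) y = of_real r * cinner x y"
  by (simp add: scaleR_L2_def)

lemma cinner_scaleR_right [simp]: "cinner x (r *\<^sub>R y) = of_real r * cinner x y"
  by (simp add: scaleR_L2_def)

lemma cinner_minus_left [simp]: "cinner (- x) y = - cinner x y"
  by (simp add: uminus_L2_def)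

lemma cinner_diff_left: "cinner (x - y) z = cinner x z - cinner y z"
  using cinner_add_left[of x "- y" z] by simp

lemma cinner_zero_left [simp]: "cinner 0 y = 0"
  using cinner_diff_left[of 0 0 y] by simp

lemma cinner_self: "cinner x x = complex_of_real ((norm x)\<^sup>2)"
proof -
  have "Im (cinner x x) = 0"
    using arg_cong[OF cinner_commute[of x x], of Im] by simp
  then show ?thesis
    by (simp add: complex_eq_iff power2_norm_eq_inner inner_L2_def)
qed

lemma norm_scaleC [simp]: "norm (scaleC c x) = cmod c * norm x"
proof -
  have "complex_of_real ((norm (scaleC c x))\<^sup>2) = complex_of_real ((cmod c * norm x)\<^sup>2)"
    unfolding cinner_self[symmetric] power_mult_distrib of_real_mult complex_norm_square[of c] by simp
  then have "(norm (scaleC c x))\<^sup>2 = (cmod c * norm x)\<^sup>2"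
    using of_real_eq_iff by blast
  then show ?thesis by (simp add: power2_eq_iff_nonneg)
qed

lemma cinner_Cauchy_Schwarz: "cmod (cinner x y) \<le> norm x * norm y"
proof (cases "cinner x y = 0")
  case False
  \<comment> \<open>A phase of modulus 1 that rotates the inner product onto its modulus, so that
    the Cauchy-Schwarz inequality of the real inner product yields the complex one.\<close>
  define c where "c = cnj (cinner x y) / cmod (cinner x y)"
  have c: "cmod c = 1"
    using False by (simp add: c_def norm_divide)
  have "c * cinner x y = cmod (cinner x y)"
    using False by (simp add: c_def mult.commute[of "cnj _"] complex_norm_square[symmetric] power2_eq_square)
  then have "cmod (cinner x y) = Re (cinner (scaleC c x) y)"
    by simp
  also have "\<dots> = scaleC c x \<bullet> y"
    by (simp add: inner_L2_def)
  also have "\<dots> \<le> norm (scaleC c x) * norm y"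
    by (rule norm_cauchy_schwarz)
  finally show ?thesis by (simp add: c)
qed simp

lemma cinner_eqI:
  assumes "\<And>z. cinner x z = cinner y z" shows "x = y"
proof -
  have "(norm (x - y))\<^sup>2 = 0"
    using assms[of "x - y"] cinner_self[of "x - y"]
    by (metis cinner_diff_left of_real_eq_0_iff right_minus_eq)
  then show ?thesis by simp
qed

lemma bounded_bilinear_cinner: "bounded_bilinear (cinner :: 'g::haar_group L2 \<Rightarrow> 'g L2 \<Rightarrow> complex)"
proof
  show "\<exists>K. \<forall>x y :: 'g L2. cmod (cinner x y) \<le> norm x * norm y * K"
    using cinner_Cauchy_Schwarz by (intro exI[of _ 1] allI) simp
qed (simp_all add: cinner_add_left cinner_add_right scaleR_conv_of_real)

lemma norm_left_regular [simp]: "norm (left_regular s \<xi>) = norm \<xi>"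
proof (cases \<xi> rule: L2_cases)
  case (1 f)
  have [measurable]: "f \<in> borel_measurable borel"
    using 1 by (auto intro: square_integrable_measurable)
  have "(LINT t|haar. (cmod (f (- s + t)))\<^sup>2) = (LINT t|distr haar borel (\<lambda>t. - s + t). (cmod (f t))\<^sup>2)"
    by (subst integral_distr) auto
  then have "(norm (left_regular s \<xi>))\<^sup>2 = (norm \<xi>)\<^sup>2"
    using 1 by (simp add: left_regular_abs norm_abs_L2 square_integrable_translate distr_haar_translation)
  then show ?thesis by simp
qed

lemma cmod_coefficient_le: "cmod (coefficient \<xi> \<eta> s) \<le> norm \<xi> * norm \<eta>"
  using cinner_Cauchy_Schwarz[of "left_regular s \<xi>" \<eta>] by (simp add: coefficient_def)

section \<open>Norms as nonnegative integrals, and completeness\<close>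

lemma nn_integral_square_eq:
  assumes "square_integrable f"
  shows "(\<integral>\<^sup>+x. ennreal ((cmod (f x))\<^sup>2) \<partial>haar) = ennreal ((norm (abs_L2 f))\<^sup>2)"
  using assms by (subst nn_integral_eq_integral) (auto simp: square_integrable_def norm_abs_L2)

text \<open>Riesz--Fischer: writing \<open>g\<^sub>n\<close> for the modulus of the \<open>n\<close>-th increment of a rapidly Cauchy
  subsequence, \<open>g\<^sub>n \<le> 2\<^sup>-\<^sup>n + 2\<^sup>n g\<^sub>n\<^sup>2\<close> is almost everywhere summable, which replaces Minkowski's
  inequality; Fatou's lemma then identifies the limit.\<close>

lemma Cauchy_L2_convergent:
  fixes X :: "nat \<Rightarrow> 'g::haar_group L2"
  assumes "Cauchy X" shows "convergent X"
proof -
  define f where "f n = (SOME f. square_integrable f \<and> X n = abs_L2 f)" for n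
  have f: "square_integrable (f n)" "X n = abs_L2 (f n)" for n
    using someI_ex[of "\<lambda>f. square_integrable f \<and> X n = abs_L2 f"] L2_cases[of "X n"]
    unfolding f_def by blast+
  have [measurable]: "f n \<in> borel_measurable borel" for n
    using f by (auto intro: square_integrable_measurable)
  have nn: "(\<integral>\<^sup>+x. ennreal ((cmod (f m x - f n x))\<^sup>2) \<partial>haar) = ennreal ((norm (X m - X n))\<^sup>2)" for m n
    using nn_integral_square_eq[OF square_integrable_diff[OF f(1) f(1)], of m n]
    by (simp add: f minus_abs)
  have "\<exists>N. \<forall>m\<ge>N. \<forall>n\<ge>N. norm (X m - X n) < (1/2)^k" for k :: nat
    using \<open>Cauchy X\<close> unfolding Cauchy_iff by simp
  then obtain N where N: "\<And>k m n. m \<ge> N k \<Longrightarrow> n \<ge> N k \<Longrightarrow> norm (X m - X n) < (1/2)^k"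
    by metis
  \<comment> \<open>Partial sums of \<open>N\<close> are nondecreasing and dominate
    \<open>N\<close>, so \<open>r n\<close> and \<open>r (Suc n)\<close> both lie beyond
    \<open>N n\<close>.\<close>
  define r where "r k = (\<Sum>i\<le>k. N i)" for k
  have rN: "N k \<le> r k" and rS: "r k \<le> r (Suc k)" for k
    by (auto simp: r_def intro: member_le_sum)
  have r_mono: "r i \<le> r j" if "i \<le> j" for i j
    using rS that by (rule lift_Suc_mono_le)
  define g where "g n x = cmod (f (r (Suc n)) x - f (r n) x)" for n x
  have [measurable]: "g n \<in> borel_measurable borel" for n
    unfolding g_def by measurable
  \<comment> \<open>The integral of \<open>(g n x)\<^sup>2\<close> is at most
    \<open>(1/4)^n\<close>, so even with the weight \<open>2^n\<close> the integrals form a summable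
    series.\<close>
  have "(\<integral>\<^sup>+x. (\<Sum>n. ennreal (2^n * (g n x)\<^sup>2)) \<partial>haar) = (\<Sum>n. \<integral>\<^sup>+x. ennreal (2^n * (g n x)\<^sup>2) \<partial>haar)"
    by (intro nn_integral_suminf) measurable
  also have "\<dots> \<le> (\<Sum>n. ennreal ((1/2)^n))"
  proof (intro suminf_le)
    fix n
    have "(\<integral>\<^sup>+x. ennreal (2^n * (g n x)\<^sup>2) \<partial>haar) = ennreal (2^n) * (\<integral>\<^sup>+x. ennreal ((g n x)\<^sup>2) \<partial>haar)"
      by (subst nn_integral_cmult[symmetric]) (auto simp: ennreal_mult')
    also have "\<dots> = ennreal (2^n * (norm (X (r (Suc n)) - X (r n)))\<^sup>2)"
      unfolding g_def nn by (simp add: ennreal_mult')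
    also have "\<dots> \<le> ennreal ((1/2)^n)"
    proof (rule ennreal_leI)
      have "(norm (X (r (Suc n)) - X (r n)))\<^sup>2 \<le> ((1/2)^n)\<^sup>2"
        using N[of n "r (Suc n)" "r n"] rN[of n] rS[of n] by (intro power_mono) auto
      then have "2^n * (norm (X (r (Suc n)) - X (r n)))\<^sup>2 \<le> 2^n * ((1/2)^n)\<^sup>2"
        by (intro mult_left_mono) auto
      also have "\<dots> = (1/2 :: real)^n"
        by (simp add: power2_eq_square power_mult_distrib[symmetric] mult.assoc[symmetric])
      finally show "2^n * (norm (X (r (Suc n)) - X (r n)))\<^sup>2 \<le> (1/2)^n" .
    qed
    finally show "(\<integral>\<^sup>+x. ennreal (2^n * (g n x)\<^sup>2) \<partial>haar) \<le> ennreal ((1/2)^n)" .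
  qed auto
  also have "\<dots> < \<infinity>"
    by (subst suminf_ennreal2) (auto simp: summable_geometric)
  finally have "AE x in haar. (\<Sum>n. ennreal (2^n * (g n x)\<^sup>2)) \<noteq> \<infinity>"
    by (intro nn_integral_PInf_AE) auto
  then have conv: "AE x in haar. (\<lambda>n. f (r n) x) \<longlonglongrightarrow> lim (\<lambda>n. f (r n) x)"
  proof eventually_elim
    fix x assume "(\<Sum>n. ennreal (2^n * (g n x)\<^sup>2)) \<noteq> \<infinity>"
    then have s: "summable (\<lambda>n. 2^n * (g n x)\<^sup>2)"
      by (intro summable_suminf_not_top) auto
    have "summable (\<lambda>n. f (r (Suc n)) x - f (r n) x)"
    proof (rule summable_comparison_test')
      show "summable (\<lambda>n. (1/2)^n + 2^n * (g n x)\<^sup>2)"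
        using s by (intro summable_add summable_geometric) auto
      fix n :: nat
      \<comment> \<open>This is \<open>2 * t \<le> 1 + t\<^sup>2\<close> for
        \<open>t = 2^n * g n x\<close>; multiplication by \<open>(1/2)^n\<close> then produces the
        summable majorant.\<close>
      have "2 * (2^n * g n x) \<le> 1 + (2^n * g n x)\<^sup>2"
        using zero_le_power2[of "1 - 2^n * g n x"] by (simp add: power2_diff)
      moreover have "0 \<le> 2^n * g n x" by (simp add: g_def)
      ultimately have "2^n * g n x \<le> 1 + (2^n * g n x)\<^sup>2" by linarith
      then have "(1/2)^n * (2^n * g n x) \<le> (1/2)^n * (1 + (2^n * g n x)\<^sup>2)"
        by (intro mult_left_mono) auto
      also have "\<dots> = (1/2)^n + 2^n * (g n x)\<^sup>2"
        by (simp add: field_simps power2_eq_square)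
      finally show "norm (f (r (Suc n)) x - f (r n) x) \<le> (1/2)^n + 2^n * (g n x)\<^sup>2"
        by (simp add: g_def power_one_over)
    qed
    then have "convergent (\<lambda>n. \<Sum>i<n. f (r (Suc i)) x - f (r i) x)"
      by (simp add: summable_iff_convergent)
    then have "convergent (\<lambda>n. f (r n) x - f (r 0) x)"
      by (simp add: sum_lessThan_telescope[of "\<lambda>n. f (r n) x"])
    then have "convergent (\<lambda>n. f (r n) x)"
      using convergent_add_const_iff[of "- f (r 0) x" "\<lambda>n. f (r n) x"] by (simp add: add.commute)
    then show "(\<lambda>n. f (r n) x) \<longlonglongrightarrow> lim (\<lambda>n. f (r n) x)"
      by (simp add: convergent_LIMSEQ_iff)
  qed
  define F where "F x = lim (\<lambda>n. f (r n) x)" for x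
  have [measurable]: "F \<in> borel_measurable borel"
    unfolding F_def by measurable
  \<comment> \<open>Only the index going to infinity runs through the subsequence, while
    \<open>n\<close> is any index beyond \<open>r k\<close>; hence the whole sequence
    \<open>X\<close> is seen to converge.\<close>
  have Fatou: "(\<integral>\<^sup>+x. ennreal ((cmod (F x - f n x))\<^sup>2) \<partial>haar) \<le> ennreal (((1/2)^k)\<^sup>2)"
    if "n \<ge> r k" for n k
  proof -
    have "(\<integral>\<^sup>+x. ennreal ((cmod (F x - f n x))\<^sup>2) \<partial>haar)
      = (\<integral>\<^sup>+x. liminf (\<lambda>m. ennreal ((cmod (f (r m) x - f n x))\<^sup>2)) \<partial>haar)"
    proof (rule nn_integral_cong_AE, use conv in eventually_elim)
      fix x assume "(\<lambda>n. f (r n) x) \<longlonglongrightarrow> lim (\<lambda>n. f (r n) x)"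
      then have "(\<lambda>m. ennreal ((cmod (f (r m) x - f n x))\<^sup>2)) \<longlonglongrightarrow> ennreal ((cmod (F x - f n x))\<^sup>2)"
        unfolding F_def by (intro tendsto_intros tendsto_ennrealI)
      then show "ennreal ((cmod (F x - f n x))\<^sup>2) = liminf (\<lambda>m. ennreal ((cmod (f (r m) x - f n x))\<^sup>2))"
        by (intro lim_imp_Liminf[symmetric]) simp_all
    qed
    also have "\<dots> \<le> liminf (\<lambda>m. \<integral>\<^sup>+x. ennreal ((cmod (f (r m) x - f n x))\<^sup>2) \<partial>haar)"
      by (intro nn_integral_liminf) measurable
    also have "\<dots> \<le> ennreal (((1/2)^k)\<^sup>2)"
    proof (rule Liminf_le)
      show "\<forall>\<^sub>F m in sequentially. (\<integral>\<^sup>+x. ennreal ((cmod (f (r m) x - f n x))\<^sup>2) \<partial>haar) \<le> ennreal (((1/2)^k)\<^sup>2)"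
        using eventually_ge_at_top[of k]
      proof eventually_elim
        fix m assume "k \<le> m"
        then have "norm (X (r m) - X n) < (1/2)^k"
          using N[of k "r m" n] rN[of k] r_mono[of k m] that by linarith
        then show "(\<integral>\<^sup>+x. ennreal ((cmod (f (r m) x - f n x))\<^sup>2) \<partial>haar) \<le> ennreal (((1/2)^k)\<^sup>2)"
          unfolding nn by (intro ennreal_leI power_mono) auto
      qed
    qed simp
    finally show ?thesis .
  qed
  \<comment> \<open>The case \<open>k = 0\<close> of the Fatou bound already gives finiteness;
    adding \<open>f (r 0)\<close> back then shows that \<open>F\<close> is square
    integrable.\<close>
  have sqd: "square_integrable (\<lambda>x. F x - f n x)" if "n \<ge> r 0" for n
    unfolding square_integrable_def
  proof
    show "integrable haar (\<lambda>x. (cmod (F x - f n x))\<^sup>2)"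
    proof (rule integrableI_bounded)
      show "(\<integral>\<^sup>+x. ennreal (norm ((cmod (F x - f n x))\<^sup>2)) \<partial>haar) < \<infinity>"
        using Fatou[of 0 n] that by (simp add: order.strict_trans1)
    qed measurable
  qed measurable
  have F: "square_integrable F"
    using square_integrable_add[OF sqd[OF order_refl] f(1)[of "r 0"]] by simp
  have "X \<longlonglongrightarrow> abs_L2 F"
  proof (rule LIMSEQ_I)
    fix e :: real assume "e > 0"
    then obtain k where k: "(1/2)^k < e"
      using real_arch_pow_inv[of e "1/2"] by auto
    have "norm (X n - abs_L2 F) < e" if "n \<ge> r k" for n
    proof -
      have "ennreal ((norm (abs_L2 F - X n))\<^sup>2) \<le> ennreal (((1/2)^k)\<^sup>2)"
        using Fatou[OF that] nn_integral_square_eq[OF square_integrable_diff[OF F f(1)[of n]]]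
        by (simp add: f(2) minus_abs F f(1))
      then have "(norm (abs_L2 F - X n))\<^sup>2 \<le> ((1/2)^k)\<^sup>2"
        by (simp add: ennreal_le_iff)
      then have "norm (abs_L2 F - X n) \<le> (1/2)^k"
        by (rule power2_le_imp_le) simp
      then show ?thesis using k by (simp add: norm_minus_commute)
    qed
    then show "\<exists>no. \<forall>n\<ge>no. norm (X n - abs_L2 F) < e" by blast
  qed
  then show ?thesis by (rule convergentI)
qed

instance L2 :: (haar_group) banach
  by standard (rule Cauchy_L2_convergent)

section \<open>Haar measure on second countable groups and convolution\<close>

text \<open>Open sets contained in compact sets cover the group; by Lindelof countably many suffice,
  and finite unions of the surrounding compact sets increase to everything. Used for
  sigma-finiteness and for truncating vectors.\<close>

lemma compact_exhaustion:
  obtains C :: "nat \<Rightarrow> 'g::{haar_group, second_countable_topology} set"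
  where "\<And>n. compact (C n)" "incseq C" "(\<Union>n. C n) = UNIV"
proof -
  define \<F> where "\<F> = {U :: 'g set. open U \<and> (\<exists>K. compact K \<and> U \<subseteq> K)}"
  have "\<Union>\<F> = UNIV"
    using locally_compact unfolding \<F>_def by blast
  moreover obtain \<F>' where \<F>': "\<F>' \<subseteq> \<F>" "countable \<F>'" "\<Union>\<F>' = \<Union>\<F>"
    using Lindelof[of \<F>] unfolding \<F>_def by blast
  ultimately have ne: "\<F>' \<noteq> {}" by auto
  define U where "U = from_nat_into \<F>'"
  have U: "U n \<in> \<F>'" for n
    unfolding U_def by (rule from_nat_into[OF ne])
  have "\<exists>K. compact K \<and> U n \<subseteq> K" for n
    using U[of n] \<F>'(1) unfolding \<F>_def by blast
  then obtain K where K: "\<And>n. compact (K n)" "\<And>n. U n \<subseteq> K n"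
    by metis
  have "range U = \<F>'"
    unfolding U_def using \<F>'(2) ne by (rule range_from_nat_into[rotated])
  then have "(\<Union>n. U n) = UNIV"
    using \<open>\<Union>\<F> = UNIV\<close> \<F>'(3) by simp
  show ?thesis
  proof (rule that[of "\<lambda>n. \<Union>i\<le>n. K i"])
    show "compact (\<Union>i\<le>n. K i)" for n
      using K(1) by (intro compact_UN) auto
    show "incseq (\<lambda>n. \<Union>i\<le>n. K i)"
      unfolding incseq_def by force
    show "(\<Union>n. \<Union>i\<le>n. K i) = UNIV"
    proof (rule set_eqI, rule iffI)
      fix x :: 'g
      obtain n where "x \<in> U n" using \<open>(\<Union>n. U n) = UNIV\<close> by auto
      then have "x \<in> K n" using K(2) by blast
      then show "x \<in> (\<Union>n. \<Union>i\<le>n. K i)" by blast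
    qed simp
  qed
qed

lemma emeasure_haar_compact:
  fixes K :: "'g::haar_group set"
  assumes "compact K" shows "emeasure haar K < \<infinity>"
proof -
  have "\<forall>K :: 'g set. compact K \<longrightarrow> emeasure haar K < \<infinity>"
    using left_haar_measure_haar[where 'a='g] unfolding left_haar_measure_def by (elim conjE)
  then show ?thesis using assms by blast
qed

lemma sets_borel_compact: "compact K \<Longrightarrow> K \<in> sets borel" for K :: "'g::haar_group set"
  by (intro borel_closed compact_imp_closed)

text \<open>Haar measure is finite on the members of a compact exhaustion. All uses of Fubini and
  Tonelli below rest on this.\<close>

lemma sigma_finite_haar:
  "sigma_finite_measure (haar :: 'g::{haar_group, second_countable_topology} measure)"
proof
  obtain C :: "nat \<Rightarrow> 'g set" where C: "\<And>n. compact (C n)" "incseq C" "(\<Union>n. C n) = UNIV"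
    by (rule compact_exhaustion) (rule that)
  show "\<exists>A. countable A \<and> A \<subseteq> sets haar \<and> \<Union>A = space haar \<and>
      (\<forall>a\<in>A. emeasure (haar :: 'g measure) a \<noteq> \<infinity>)"
  proof (intro exI conjI ballI)
    show "range C \<subseteq> sets haar"
      using C(1) by (auto simp: sets_borel_compact)
    show "\<Union>(range C) = space haar"
      using C(3) by simp
    fix a assume "a \<in> range C"
    then have "compact a" using C(1) by auto
    then show "emeasure haar a \<noteq> \<infinity>"
      using emeasure_haar_compact[of a] by simp
  qed simp
qed

lemma pair_sigma_finite_haar:
  "pair_sigma_finite (haar :: 'g::{haar_group, second_countable_topology} measure)
     (haar :: 'g measure)"
  by (intro pair_sigma_finite.intro sigma_finite_haar)

text \<open>By second countability the Borel sets of the product are generated by measurable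
  rectangles (\<open>borel_prod\<close>), so the continuous group operation is measurable for the
  product sigma-algebra on which Fubini works.\<close>

lemma measurable_add_pair [measurable]:
  fixes f g :: "'b \<Rightarrow> 'g::{haar_group, second_countable_topology}"
  assumes [measurable]: "f \<in> borel_measurable M" "g \<in> borel_measurable M"
  shows "(\<lambda>x. f x + g x) \<in> borel_measurable M"
proof -
  have "(\<lambda>p :: 'g \<times> 'g. fst p + snd p) \<in> borel_measurable borel"
    by (intro borel_measurable_continuous_onI continuous_intros)
  then have [measurable]: "(\<lambda>p :: 'g \<times> 'g. fst p + snd p) \<in> borel_measurable (borel \<Otimes>\<^sub>M borel)"
    by (simp add: borel_prod)
  have "(\<lambda>x. fst (f x, g x) + snd (f x, g x)) \<in> borel_measurable M"
    by measurable
  then show ?thesis by simp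
qed

lemma measurable_uminus_group [measurable]:
  fixes f :: "'b \<Rightarrow> 'g::haar_group"
  assumes [measurable]: "f \<in> borel_measurable M"
  shows "(\<lambda>x. - f x) \<in> borel_measurable M"
proof -
  have [measurable]: "(uminus :: 'g \<Rightarrow> 'g) \<in> borel_measurable borel"
    by (intro borel_measurable_continuous_onI continuous_intros)
  show ?thesis by measurable
qed

lemma measurable_cnj [measurable]:
  assumes [measurable]: "f \<in> borel_measurable M"
  shows "(\<lambda>x. cnj (f x)) \<in> borel_measurable M"
proof -
  have [measurable]: "cnj \<in> borel_measurable borel"
    by (intro borel_measurable_continuous_onI continuous_intros)
  show ?thesis by measurable
qed

lemma nn_integral_haar_translate:
  fixes h :: "'g::haar_group \<Rightarrow> ennreal"
  assumes [measurable]: "h \<in> borel_measurable borel"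
  shows "(\<integral>\<^sup>+t. h (s + t) \<partial>haar) = (\<integral>\<^sup>+t. h t \<partial>haar)"
proof -
  have "(\<integral>\<^sup>+t. h t \<partial>haar) = (\<integral>\<^sup>+t. h t \<partial>distr haar borel (\<lambda>t. s + t))"
    by (simp add: distr_haar_translation)
  then show ?thesis by (simp add: nn_integral_distr)
qed

lemma integral_haar_translate:
  fixes h :: "'g::haar_group \<Rightarrow> complex"
  assumes [measurable]: "h \<in> borel_measurable borel"
  shows "(LINT t|haar. h (s + t)) = (LINT t|haar. h t)"
proof -
  have "(LINT t|haar. h t) = (LINT t|distr haar borel (\<lambda>t. s + t). h t)"
    by (simp add: distr_haar_translation)
  then show ?thesis by (simp add: integral_distr)
qed

section \<open>Coefficient functions and convolution vectors\<close>

lemma coefficient_abs: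
  assumes "square_integrable a" "square_integrable b"
  shows "coefficient (abs_L2 a) (abs_L2 b) s = (LINT t|haar. a (- s + t) * cnj (b t))"
  using assms by (simp add: coefficient_def left_regular_abs cinner_abs square_integrable_translate)

lemma borel_measurable_coefficient [measurable]:
  fixes \<xi> \<eta> :: "'g::{haar_group, second_countable_topology} L2"
  shows "coefficient \<xi> \<eta> \<in> borel_measurable borel"
proof -
  obtain a where a: "square_integrable a" "\<xi> = abs_L2 a" by (rule L2_cases)
  obtain b where b: "square_integrable b" "\<eta> = abs_L2 b" by (rule L2_cases)
  have [measurable]: "a \<in> borel_measurable borel" "b \<in> borel_measurable borel"
    using a b by (auto intro: square_integrable_measurable)
  interpret sigma_finite_measure "haar :: 'g measure" by (rule sigma_finite_haar)
  have "(\<lambda>s. LINT t|haar. a (- s + t) * cnj (b t)) \<in> borel_measurable borel"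
    by measurable
  then show ?thesis
    using a b by (simp add: coefficient_abs cong: measurable_cong)
qed

lemma integrable_mult_coefficient:
  fixes f :: "'g::{haar_group, second_countable_topology} \<Rightarrow> complex"
  assumes "integrable haar f"
  shows "integrable haar (\<lambda>s. f s * coefficient \<xi> \<eta> s)"
proof (rule Bochner_Integration.integrable_bound)
  show "integrable haar (\<lambda>s. (norm \<xi> * norm \<eta>) * norm (f s))"
    using assms by (intro integrable_mult_right integrable_norm)
  have [measurable]: "f \<in> borel_measurable haar"
    using assms by auto
  show "(\<lambda>s. f s * coefficient \<xi> \<eta> s) \<in> borel_measurable haar"
    by measurable
  show "AE s in haar. norm (f s * coefficient \<xi> \<eta> s) \<le> norm (norm \<xi> * norm \<eta> * norm (f s))"
    using cmod_coefficient_le[of \<xi> \<eta>]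
    by (intro AE_I2) (simp add: norm_mult mult.commute mult_left_mono)
qed

text \<open>The vector \<open>\<lambda>(f)\<xi>\<close> is the convolution of \<open>f\<close> and \<open>\<xi>\<close>, which is square integrable because
  \<open>|f * \<xi>|\<^sup>2 \<le> \<parallel>f\<parallel>\<^sub>1 (|f| * |\<xi>|\<^sup>2)\<close> by the Cauchy--Schwarz inequality.\<close>

lemma convolution_vector_exists:
  fixes f :: "'g::{haar_group, second_countable_topology} \<Rightarrow> complex"
  assumes f: "integrable haar f"
  shows "\<exists>\<zeta>. \<forall>\<eta>. cinner \<zeta> \<eta> = (LINT s|haar. f s * cinner (left_regular s \<xi>) \<eta>)"
proof -
  interpret sigma_finite_measure "haar :: 'g measure" by (rule sigma_finite_haar)
  interpret P: pair_sigma_finite "haar :: 'g measure" "haar :: 'g measure"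
    by (rule pair_sigma_finite_haar)
  obtain a where a: "square_integrable a" "\<xi> = abs_L2 a" by (rule L2_cases)
  have [measurable]: "a \<in> borel_measurable borel"
    using a by (auto intro: square_integrable_measurable)
  have "f \<in> borel_measurable haar" using f by auto
  then have [measurable]: "f \<in> borel_measurable borel"
    by (simp add: measurable_cong_sets[OF sets_haar refl])
  define A where "A = (\<integral>\<^sup>+s. ennreal (cmod (f s)) \<partial>haar)"
  have A: "A < \<infinity>" unfolding A_def using f by (simp add: integrable_iff_bounded)
  \<comment> \<open>The convolution of the moduli, taken in the extended nonnegative reals: it is
    defined everywhere and dominates the convolution \<open>g\<close> introduced below.\<close>
  define c where "c t = (\<integral>\<^sup>+s. ennreal (cmod (f s)) * ennreal (cmod (a (- s + t))) \<partial>haar)" for t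
  have [measurable]: "c \<in> borel_measurable borel"
    unfolding c_def by measurable
  have c2: "(c t)\<^sup>2 \<le> A * (\<integral>\<^sup>+s. ennreal (cmod (f s)) * ennreal ((cmod (a (- s + t)))\<^sup>2) \<partial>haar)" for t
  proof -
    \<comment> \<open>Splitting \<open>cmod (f s)\<close> into two square roots makes Cauchy-Schwarz
      return one factor \<open>A\<close> and one copy of \<open>cmod (f s)\<close> as a weight on
      the square.\<close>
    have "c t = (\<integral>\<^sup>+s. ennreal (sqrt (cmod (f s))) * ennreal (sqrt (cmod (f s)) * cmod (a (- s + t))) \<partial>haar)"
      unfolding c_def by (intro nn_integral_cong) (simp add: ennreal_mult[symmetric] mult.assoc[symmetric])
    also have "\<dots>\<^sup>2 \<le> (\<integral>\<^sup>+s. (ennreal (sqrt (cmod (f s))))\<^sup>2 \<partial>haar) *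
        (\<integral>\<^sup>+s. (ennreal (sqrt (cmod (f s)) * cmod (a (- s + t))))\<^sup>2 \<partial>haar)"
      by (rule Cauchy_Schwarz_nn_integral) measurable
    also have "\<dots> = A * (\<integral>\<^sup>+s. ennreal (cmod (f s)) * ennreal ((cmod (a (- s + t)))\<^sup>2) \<partial>haar)"
      unfolding A_def by (simp add: ennreal_power power_mult_distrib ennreal_mult[symmetric])
    finally show ?thesis .
  qed
  have "(\<integral>\<^sup>+t. (c t)\<^sup>2 \<partial>haar)
      \<le> (\<integral>\<^sup>+t. A * (\<integral>\<^sup>+s. ennreal (cmod (f s)) * ennreal ((cmod (a (- s + t)))\<^sup>2) \<partial>haar) \<partial>haar)"
    by (intro nn_integral_mono c2)
  also have "\<dots> = A * (\<integral>\<^sup>+t. \<integral>\<^sup>+s. ennreal (cmod (f s)) * ennreal ((cmod (a (- s + t)))\<^sup>2) \<partial>haar \<partial>haar)"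
    by (rule nn_integral_cmult) measurable
  also have "(\<integral>\<^sup>+t. \<integral>\<^sup>+s. ennreal (cmod (f s)) * ennreal ((cmod (a (- s + t)))\<^sup>2) \<partial>haar \<partial>haar)
      = (\<integral>\<^sup>+s. \<integral>\<^sup>+t. ennreal (cmod (f s)) * ennreal ((cmod (a (- s + t)))\<^sup>2) \<partial>haar \<partial>haar)"
    by (rule P.Fubini') measurable
  also have "\<dots> = (\<integral>\<^sup>+s. ennreal (cmod (f s)) * ennreal ((norm \<xi>)\<^sup>2) \<partial>haar)"
  proof (intro nn_integral_cong)
    fix s
    have "(\<integral>\<^sup>+t. ennreal (cmod (f s)) * ennreal ((cmod (a (- s + t)))\<^sup>2) \<partial>haar)
        = ennreal (cmod (f s)) * (\<integral>\<^sup>+t. ennreal ((cmod (a (- s + t)))\<^sup>2) \<partial>haar)"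
      by (rule nn_integral_cmult) measurable
    also have "(\<integral>\<^sup>+t. ennreal ((cmod (a (- s + t)))\<^sup>2) \<partial>haar) = ennreal ((norm \<xi>)\<^sup>2)"
      using nn_integral_haar_translate[of "\<lambda>t. ennreal ((cmod (a t))\<^sup>2)" "- s"]
      by (simp add: a nn_integral_square_eq)
    finally show "(\<integral>\<^sup>+t. ennreal (cmod (f s)) * ennreal ((cmod (a (- s + t)))\<^sup>2) \<partial>haar)
        = ennreal (cmod (f s)) * ennreal ((norm \<xi>)\<^sup>2)" .
  qed
  also have "\<dots> = A * ennreal ((norm \<xi>)\<^sup>2)"
    unfolding A_def by (rule nn_integral_multc) measurable
  also have "A * (A * ennreal ((norm \<xi>)\<^sup>2)) < \<infinity>"
    using A by (simp add: ennreal_mult_less_top)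
  finally have cfin: "(\<integral>\<^sup>+t. (c t)\<^sup>2 \<partial>haar) < \<infinity>" .
  define g where "g t = (LINT s|haar. f s * a (- s + t))" for t
  have [measurable]: "g \<in> borel_measurable borel"
    unfolding g_def by measurable
  \<comment> \<open>Where the integrand is not integrable, the Bochner integral has the default
    value 0 and the bound is trivial.\<close>
  have gc: "ennreal (cmod (g t)) \<le> c t" for t
    using integral_norm_bound_ennreal[of haar "\<lambda>s. f s * a (- s + t)"] not_integrable_integral_eq[of haar "\<lambda>s. f s * a (- s + t)"]
    unfolding g_def c_def by (cases "integrable haar (\<lambda>s. f s * a (- s + t))") (auto simp: norm_mult ennreal_mult)
  have g: "square_integrable g"
    unfolding square_integrable_def
  proof
    show "integrable haar (\<lambda>x. (cmod (g x))\<^sup>2)"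
    proof (rule integrableI_bounded)
      have "(\<integral>\<^sup>+x. ennreal (norm ((cmod (g x))\<^sup>2)) \<partial>haar) \<le> (\<integral>\<^sup>+t. (c t)\<^sup>2 \<partial>haar)"
        using gc by (intro nn_integral_mono) (simp add: ennreal_power[symmetric] power_mono)
      then show "(\<integral>\<^sup>+x. ennreal (norm ((cmod (g x))\<^sup>2)) \<partial>haar) < \<infinity>"
        using cfin by (rule order.strict_trans1)
    qed measurable
  qed measurable
  show ?thesis
  proof (intro exI allI)
    fix \<eta> :: "'g L2"
    obtain b where b: "square_integrable b" "\<eta> = abs_L2 b" by (rule L2_cases)
    have [measurable]: "b \<in> borel_measurable borel"
      using b by (auto intro: square_integrable_measurable)
    \<comment> \<open>Integrating the modulus over \<open>s\<close> first leaves
      \<open>c t * cmod (b t)\<close>, a product of two square integrable factors; this gives the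
      absolute integrability that Fubini requires.\<close>
    have "integrable (haar \<Otimes>\<^sub>M haar) (\<lambda>(s, t). f s * a (- s + t) * cnj (b t))"
    proof (rule integrableI_bounded)
      have "(\<integral>\<^sup>+p. ennreal (norm (case p of (s, t) \<Rightarrow> f s * a (- s + t) * cnj (b t))) \<partial>(haar \<Otimes>\<^sub>M haar))
        = (\<integral>\<^sup>+s. \<integral>\<^sup>+t. ennreal (norm (f s * a (- s + t) * cnj (b t))) \<partial>haar \<partial>haar)"
        by (subst nn_integral_fst[symmetric]) simp_all
      also have "\<dots> = (\<integral>\<^sup>+t. \<integral>\<^sup>+s. ennreal (norm (f s * a (- s + t) * cnj (b t))) \<partial>haar \<partial>haar)"
        by (rule P.Fubini'[symmetric]) measurable
      also have "\<dots> = (\<integral>\<^sup>+t. c t * ennreal (cmod (b t)) \<partial>haar)"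
      proof (intro nn_integral_cong)
        fix t
        have "(\<integral>\<^sup>+s. ennreal (norm (f s * a (- s + t) * cnj (b t))) \<partial>haar)
          = (\<integral>\<^sup>+s. ennreal (cmod (f s)) * ennreal (cmod (a (- s + t))) * ennreal (cmod (b t)) \<partial>haar)"
          by (intro nn_integral_cong) (simp add: norm_mult ennreal_mult)
        also have "\<dots> = c t * ennreal (cmod (b t))"
          unfolding c_def by (rule nn_integral_multc) measurable
        finally show "(\<integral>\<^sup>+s. ennreal (norm (f s * a (- s + t) * cnj (b t))) \<partial>haar) = c t * ennreal (cmod (b t))" .
      qed
      also have "\<dots> < \<infinity>"
      proof -
        have "(\<integral>\<^sup>+t. c t * ennreal (cmod (b t)) \<partial>haar)\<^sup>2
            \<le> (\<integral>\<^sup>+t. (c t)\<^sup>2 \<partial>haar) * (\<integral>\<^sup>+t. (ennreal (cmod (b t)))\<^sup>2 \<partial>haar)"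
          by (rule Cauchy_Schwarz_nn_integral) measurable
        also have "(\<integral>\<^sup>+t. (ennreal (cmod (b t)))\<^sup>2 \<partial>haar) = ennreal ((norm \<eta>)\<^sup>2)"
          using b by (simp add: ennreal_power nn_integral_square_eq)
        also have "(\<integral>\<^sup>+t. (c t)\<^sup>2 \<partial>haar) * ennreal ((norm \<eta>)\<^sup>2) < \<infinity>"
          using cfin by (simp add: ennreal_mult_less_top)
        finally show ?thesis by (simp add: power_less_top_ennreal)
      qed
      finally show "(\<integral>\<^sup>+p. ennreal (norm (case p of (s, t) \<Rightarrow> f s * a (- s + t) * cnj (b t))) \<partial>(haar \<Otimes>\<^sub>M haar)) < \<infinity>" .
    qed measurable
    then have "(LINT t|haar. LINT s|haar. f s * a (- s + t) * cnj (b t))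
        = (LINT s|haar. LINT t|haar. f s * a (- s + t) * cnj (b t))"
      by (rule P.Fubini_integral)
    then have "(LINT t|haar. g t * cnj (b t)) = (LINT s|haar. f s * (LINT t|haar. a (- s + t) * cnj (b t)))"
      unfolding g_def by (simp add: mult.assoc flip: integral_mult_left_zero)
    then show "cinner (abs_L2 g) \<eta> = (LINT s|haar. f s * cinner (left_regular s \<xi>) \<eta>)"
      using a b g by (simp add: cinner_abs left_regular_abs square_integrable_translate)
  qed
qed

section \<open>The integrated left regular representation\<close>

lemma blinfun_L2_ext:
  assumes "\<And>\<xi> \<eta>. cinner (blinfun_apply S \<xi>) \<eta> = cinner (blinfun_apply T \<xi>) \<eta>"
  shows "S = T"
  using assms by (intro blinfun_eqI cinner_eqI)

text \<open>Convolution vectors are determined by their inner products, so they inherit linearity in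
  \<xi> from the integral. Pairing \<open>C x\<close> with itself bounds its squared norm by the L1
  norm of \<open>f\<close> times \<open>norm x * norm (C x)\<close>; cancelling one factor gives
  boundedness.\<close>

lemma left_regular_L1_exists:
  fixes f :: "'g::{haar_group, second_countable_topology} \<Rightarrow> complex"
  assumes f: "integrable haar f"
  shows "\<exists>T\<in>bounded_ops. \<forall>\<xi> \<eta>. cinner (blinfun_apply T \<xi>) \<eta>
           = (LINT s|haar. f s * cinner (left_regular s \<xi>) \<eta>)"
proof -
  obtain C where C: "\<And>\<xi> \<eta>. cinner (C \<xi>) \<eta> = (LINT s|haar. f s * cinner (left_regular s \<xi>) \<eta>)"
    using convolution_vector_exists[OF f] by metis
  have add: "left_regular s (x + y) = left_regular s x + left_regular s y" for s and x y :: "'g L2"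
    by transfer (auto simp: L2_rel_def intro!: square_integrable_add square_integrable_translate)
  have scale: "left_regular s (scaleC c x) = scaleC c (left_regular s x)" for s c and x :: "'g L2"
    by transfer (auto simp: L2_rel_def intro!: square_integrable_scale square_integrable_translate)
  have int: "integrable haar (\<lambda>s. f s * cinner (left_regular s \<xi>) \<eta>)" for \<xi> \<eta>
    using integrable_mult_coefficient[OF f, of \<xi> \<eta>] by (simp add: coefficient_def)
  have C_add: "C (x + y) = C x + C y" for x y
    by (rule cinner_eqI) (simp add: C cinner_add_left add distrib_left int)
  have C_scale: "C (scaleC c x) = scaleC c (C x)" for c x
    by (rule cinner_eqI) (simp add: C scale mult.left_commute)
  have "bounded_linear C"
  proof (rule bounded_linear_intro[where K = "LINT s|haar. cmod (f s)"])
    show "C (x + y) = C x + C y" for x y by (rule C_add)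
    show "C (r *\<^sub>R x) = r *\<^sub>R C x" for r x unfolding scaleR_L2_def by (rule C_scale)
    fix x
    have "complex_of_real ((norm (C x))\<^sup>2) = (LINT s|haar. f s * cinner (left_regular s x) (C x))"
      by (simp add: cinner_self[symmetric] C del: of_real_power)
    then have "(norm (C x))\<^sup>2 = cmod (LINT s|haar. f s * cinner (left_regular s x) (C x))"
      by (metis abs_of_nonneg norm_of_real zero_le_power2)
    also have "\<dots> \<le> (LINT s|haar. cmod (f s * cinner (left_regular s x) (C x)))"
      by (rule integral_norm_bound)
    also have "\<dots> \<le> (LINT s|haar. cmod (f s) * (norm x * norm (C x)))"
    proof (rule integral_mono)
      show "cmod (f s * cinner (left_regular s x) (C x)) \<le> cmod (f s) * (norm x * norm (C x))" for s
        using cinner_Cauchy_Schwarz[of "left_regular s x" "C x"]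
        by (simp add: norm_mult mult_left_mono)
    qed (use int f in auto)
    also have "\<dots> = (norm x * (LINT s|haar. cmod (f s))) * norm (C x)"
      by simp
    finally have "norm (C x) * norm (C x) \<le> (norm x * (LINT s|haar. cmod (f s))) * norm (C x)"
      by (simp add: power2_eq_square)
    then show "norm (C x) \<le> norm x * (LINT s|haar. cmod (f s))"
      by (cases "norm (C x) = 0") (auto simp: mult_le_cancel_right)
  qed
  then show ?thesis
    using C C_scale
    by (intro bexI[of _ "Blinfun C"]) (auto simp: bounded_ops_def bounded_linear_Blinfun_apply)
qed

text \<open>The definite description in \<open>left_regular_L1\<close> denotes: an operator is
  determined by its inner products, and one with the right inner products has been
  constructed.\<close>

lemma
  fixes f :: "'g::{haar_group, second_countable_topology} \<Rightarrow> complex"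
  assumes f: "integrable haar f"
  shows left_regular_L1_bounded_ops: "left_regular_L1 f \<in> bounded_ops"
    and cinner_left_regular_L1:
      "cinner (blinfun_apply (left_regular_L1 f) \<xi>) \<eta> = (LINT s|haar. f s * coefficient \<xi> \<eta> s)"
proof -
  let ?P = "\<lambda>T. T \<in> bounded_ops \<and> (\<forall>\<xi> \<eta>. cinner (blinfun_apply T \<xi>) \<eta>
     = (LINT s|haar. f s * cinner (left_regular s \<xi>) \<eta>))"
  have "\<exists>!T. ?P T"
    using left_regular_L1_exists[OF f] by (auto intro: blinfun_L2_ext)
  then have "?P (left_regular_L1 f)"
    unfolding left_regular_L1_def by (rule theI')
  then show "left_regular_L1 f \<in> bounded_ops"
    "cinner (blinfun_apply (left_regular_L1 f) \<xi>) \<eta> = (LINT s|haar. f s * coefficient \<xi> \<eta> s)"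
    by (auto simp: coefficient_def)
qed

lemma left_regular_L1_diff:
  fixes f g :: "'g::{haar_group, second_countable_topology} \<Rightarrow> complex"
  assumes "integrable haar f" "integrable haar g"
  shows "left_regular_L1 (\<lambda>s. f s - g s) = left_regular_L1 f - left_regular_L1 g"
  using assms integrable_mult_coefficient[OF assms(1)] integrable_mult_coefficient[OF assms(2)]
  by (intro blinfun_L2_ext)
    (simp add: cinner_left_regular_L1 blinfun.diff_left cinner_diff_left left_diff_distrib)

section \<open>Fell absorption and multiplication by coefficients\<close>

lemma mult_le_sum_squares: "c * d \<le> c\<^sup>2 + d\<^sup>2" for c d :: real
  using sum_squares_bound[of c d] sum_squares_ge_zero[of c d]
  unfolding mult.assoc power2_eq_square by linarith

text \<open>Tonelli allows \<open>z\<close> to be integrated first. There \<open>s + x\<close> acts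
  as a left translation and disappears, then \<open>s\<close> disappears from the integral over
  \<open>x\<close>; only left invariance is involved, so no modular function arises.\<close>

lemma nn_integral_twist:
  fixes p a :: "'g::{haar_group, second_countable_topology} \<Rightarrow> complex"
  assumes p: "square_integrable p" and a: "square_integrable a"
  shows "(\<integral>\<^sup>+z. \<integral>\<^sup>+x. ennreal ((cmod (p (s + x) * a (s + x + z)))\<^sup>2) \<partial>haar \<partial>haar)
     = ennreal ((norm (abs_L2 p) * norm (abs_L2 a))\<^sup>2)"
proof -
  interpret sigma_finite_measure "haar :: 'g measure" by (rule sigma_finite_haar)
  interpret P: pair_sigma_finite "haar :: 'g measure" "haar :: 'g measure"
    by (rule pair_sigma_finite_haar)
  have [measurable]: "p \<in> borel_measurable borel" "a \<in> borel_measurable borel"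
    using p a by (auto intro: square_integrable_measurable)
  have "(\<integral>\<^sup>+z. \<integral>\<^sup>+x. ennreal ((cmod (p (s + x) * a (s + x + z)))\<^sup>2) \<partial>haar \<partial>haar)
    = (\<integral>\<^sup>+x. \<integral>\<^sup>+z. ennreal ((cmod (p (s + x) * a (s + x + z)))\<^sup>2) \<partial>haar \<partial>haar)"
    by (rule P.Fubini') measurable
  also have "\<dots> = (\<integral>\<^sup>+x. ennreal ((cmod (p (s + x)))\<^sup>2) * ennreal ((norm (abs_L2 a))\<^sup>2) \<partial>haar)"
  proof (intro nn_integral_cong)
    fix x
    have "(\<integral>\<^sup>+z. ennreal ((cmod (p (s + x) * a (s + x + z)))\<^sup>2) \<partial>haar)
      = (\<integral>\<^sup>+z. ennreal ((cmod (p (s + x)))\<^sup>2) * ennreal ((cmod (a (s + x + z)))\<^sup>2) \<partial>haar)"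
      by (intro nn_integral_cong) (simp add: norm_mult power_mult_distrib ennreal_mult)
    also have "\<dots> = ennreal ((cmod (p (s + x)))\<^sup>2) * (\<integral>\<^sup>+z. ennreal ((cmod (a (s + x + z)))\<^sup>2) \<partial>haar)"
      by (rule nn_integral_cmult) measurable
    also have "(\<integral>\<^sup>+z. ennreal ((cmod (a (s + x + z)))\<^sup>2) \<partial>haar) = ennreal ((norm (abs_L2 a))\<^sup>2)"
      using nn_integral_haar_translate[of "\<lambda>z. ennreal ((cmod (a z))\<^sup>2)" "s + x"]
      by (simp add: a nn_integral_square_eq)
    finally show "(\<integral>\<^sup>+z. ennreal ((cmod (p (s + x) * a (s + x + z)))\<^sup>2) \<partial>haar)
      = ennreal ((cmod (p (s + x)))\<^sup>2) * ennreal ((norm (abs_L2 a))\<^sup>2)" .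
  qed
  also have "\<dots> = (\<integral>\<^sup>+x. ennreal ((cmod (p (s + x)))\<^sup>2) \<partial>haar) * ennreal ((norm (abs_L2 a))\<^sup>2)"
    by (rule nn_integral_multc) measurable
  also have "(\<integral>\<^sup>+x. ennreal ((cmod (p (s + x)))\<^sup>2) \<partial>haar) = ennreal ((norm (abs_L2 p))\<^sup>2)"
    using nn_integral_haar_translate[of "\<lambda>z. ennreal ((cmod (p z))\<^sup>2)" s]
    by (simp add: p nn_integral_square_eq)
  finally show ?thesis by (simp add: ennreal_mult[symmetric] power_mult_distrib)
qed

text \<open>A finite double integral has finite inner integrals almost everywhere. This makes the
  slices \<open>\<xi>\<^sub>z\<close> and \<open>\<eta>\<^sub>z\<close> of the absorption argument
  vectors of the Hilbert space for almost every \<open>z\<close>.\<close>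

lemma AE_square_integrable_twist:
  fixes p a :: "'g::{haar_group, second_countable_topology} \<Rightarrow> complex"
  assumes p: "square_integrable p" and a: "square_integrable a"
  shows "AE z in haar. square_integrable (\<lambda>x. p x * a (x + z))"
proof -
  interpret sigma_finite_measure "haar :: 'g measure" by (rule sigma_finite_haar)
  have [measurable]: "p \<in> borel_measurable borel" "a \<in> borel_measurable borel"
    using p a by (auto intro: square_integrable_measurable)
  have "AE z in haar. (\<integral>\<^sup>+x. ennreal ((cmod (p x * a (x + z)))\<^sup>2) \<partial>haar) \<noteq> \<infinity>"
    using nn_integral_twist[OF p a, of 0]
    by (intro nn_integral_PInf_AE) auto
  then show ?thesis
  proof eventually_elim
    case (elim z)
    then show ?case
      unfolding square_integrable_def by (auto intro!: integrableI_bounded simp: less_top)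
  qed
qed

text \<open>Fell's absorption principle: substituting \<open>y = x z\<close> in the second factor of
  \<open>\<xi>'(s\<^sup>-\<^sup>1x) \<xi>(s\<^sup>-\<^sup>1y)\<close> turns \<open>\<lambda> \<otimes> \<lambda>\<close> into \<open>\<lambda> \<otimes> 1\<close>, so that
  \<open>\<integral> f u v = \<integral> (\<lambda>(f) \<xi>\<^sub>z, \<eta>\<^sub>z) dz\<close> with \<open>\<xi>\<^sub>z(x) = \<xi>'(x) \<xi>(xz)\<close> and \<open>\<eta>\<^sub>z(x) = \<eta>'(x) \<eta>(xz)\<close>.\<close>

lemma integral_coefficient_product_bound:
  fixes f :: "'g::{haar_group, second_countable_topology} \<Rightarrow> complex"
  assumes f: "integrable haar f"
  shows "cmod (LINT s|haar. f s * coefficient \<xi>' \<eta>' s * coefficient \<xi> \<eta> s)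
    \<le> norm (left_regular_L1 f) * ((norm \<xi>' * norm \<xi>)\<^sup>2 + (norm \<eta>' * norm \<eta>)\<^sup>2)"
proof -
  interpret sigma_finite_measure "haar :: 'g measure" by (rule sigma_finite_haar)
  interpret P: pair_sigma_finite "haar :: 'g measure" "haar :: 'g measure"
    by (rule pair_sigma_finite_haar)
  interpret PP: pair_sigma_finite "haar \<Otimes>\<^sub>M haar :: ('g \<times> 'g) measure" "haar :: 'g measure"
    by (intro pair_sigma_finite.intro sigma_finite_pair_measure sigma_finite_haar)
  obtain p where p: "square_integrable p" "\<xi>' = abs_L2 p" by (rule L2_cases)
  obtain q where q: "square_integrable q" "\<eta>' = abs_L2 q" by (rule L2_cases)
  obtain a where a: "square_integrable a" "\<xi> = abs_L2 a" by (rule L2_cases)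
  obtain b where b: "square_integrable b" "\<eta> = abs_L2 b" by (rule L2_cases)
  have [measurable]: "p \<in> borel_measurable borel" "a \<in> borel_measurable borel"
    "q \<in> borel_measurable borel" "b \<in> borel_measurable borel"
    using p a q b by (auto intro: square_integrable_measurable)
  have "f \<in> borel_measurable haar" using f by auto
  then have [measurable]: "f \<in> borel_measurable borel"
    by (simp add: measurable_cong_sets[OF sets_haar refl])
  define T where "T = left_regular_L1 f"
  define B where "B = (norm \<xi>' * norm \<xi>)\<^sup>2 + (norm \<eta>' * norm \<eta>)\<^sup>2"
  \<comment> \<open>\<open>D s z x\<close> is \<open>\<xi>\<^sub>z\<close> at \<open>- s + x\<close>
    times the conjugate of \<open>\<eta>\<^sub>z\<close> at \<open>x\<close>. Integrating over
    \<open>x\<close> gives the coefficient of the slices at \<open>s\<close>; integrating over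
    \<open>z\<close> as well gives the product of the two original coefficients.\<close>
  define D where "D s z x = p (- s + x) * a (- s + x + z) * cnj (q x * b (x + z))" for s z x
  have [measurable]: "(\<lambda>w. D (k w) (l w) (m w)) \<in> borel_measurable M"
    if [measurable]: "k \<in> borel_measurable M" "l \<in> borel_measurable M" "m \<in> borel_measurable M"
    for k l m :: "'c \<Rightarrow> 'g" and M :: "'c measure"
    unfolding D_def by measurable
  \<comment> \<open>The bound is uniform in \<open>s\<close>. The second summand is written with
    \<open>0 + x\<close> so that \<open>nn_integral_twist\<close> applies to it with translation
    0.\<close>
  have D_bound: "(\<integral>\<^sup>+z. \<integral>\<^sup>+x. ennreal (cmod (D s z x)) \<partial>haar \<partial>haar) \<le> ennreal B" for s
  proof -
    have "(\<integral>\<^sup>+z. \<integral>\<^sup>+x. ennreal (cmod (D s z x)) \<partial>haar \<partial>haar)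
      \<le> (\<integral>\<^sup>+z. \<integral>\<^sup>+x. ennreal ((cmod (p (- s + x) * a (- s + x + z)))\<^sup>2)
                    + ennreal ((cmod (q (0 + x) * b (0 + x + z)))\<^sup>2) \<partial>haar \<partial>haar)"
    proof (intro nn_integral_mono)
      fix z x
      show "ennreal (cmod (D s z x)) \<le> ennreal ((cmod (p (- s + x) * a (- s + x + z)))\<^sup>2)
                    + ennreal ((cmod (q (0 + x) * b (0 + x + z)))\<^sup>2)"
        unfolding D_def norm_mult[of "_ * _" "cnj _"] complex_mod_cnj
        by (simp add: ennreal_plus[symmetric] ennreal_leI mult_le_sum_squares del: ennreal_plus)
    qed
    also have "\<dots> = (\<integral>\<^sup>+z. (\<integral>\<^sup>+x. ennreal ((cmod (p (- s + x) * a (- s + x + z)))\<^sup>2) \<partial>haar)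
                   + (\<integral>\<^sup>+x. ennreal ((cmod (q (0 + x) * b (0 + x + z)))\<^sup>2) \<partial>haar) \<partial>haar)"
      by (intro nn_integral_cong nn_integral_add) measurable
    also have "\<dots> = (\<integral>\<^sup>+z. \<integral>\<^sup>+x. ennreal ((cmod (p (- s + x) * a (- s + x + z)))\<^sup>2) \<partial>haar \<partial>haar)
                   + (\<integral>\<^sup>+z. \<integral>\<^sup>+x. ennreal ((cmod (q (0 + x) * b (0 + x + z)))\<^sup>2) \<partial>haar \<partial>haar)"
      by (intro nn_integral_add) measurable
    also have "\<dots> = ennreal B"
      unfolding nn_integral_twist[OF p(1) a(1)] nn_integral_twist[OF q(1) b(1)]
      by (simp add: B_def p q a b)
    finally show ?thesis .
  qed
  have intD: "integrable (haar \<Otimes>\<^sub>M haar) (\<lambda>(z, x). D s z x)" for s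
  proof (rule integrableI_bounded)
    have "(\<integral>\<^sup>+w. ennreal (norm (case w of (z, x) \<Rightarrow> D s z x)) \<partial>(haar \<Otimes>\<^sub>M haar))
      = (\<integral>\<^sup>+z. \<integral>\<^sup>+x. ennreal (cmod (D s z x)) \<partial>haar \<partial>haar)"
      by (subst nn_integral_fst[symmetric]) simp_all
    then show "(\<integral>\<^sup>+w. ennreal (norm (case w of (z, x) \<Rightarrow> D s z x)) \<partial>(haar \<Otimes>\<^sub>M haar)) < \<infinity>"
      using D_bound[of s] by (simp add: order.strict_trans1)
  qed measurable
  \<comment> \<open>With \<open>z\<close> integrated first, the factors depending on
    \<open>x + z\<close> are translated by \<open>x\<close> only, and their integral is the second
    coefficient, independent of \<open>x\<close>.\<close>
  have D_eq: "(LINT z|haar. LINT x|haar. D s z x) = coefficient \<xi>' \<eta>' s * coefficient \<xi> \<eta> s" for s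
  proof -
    have "(LINT z|haar. LINT x|haar. D s z x) = (LINT x|haar. LINT z|haar. D s z x)"
      by (rule P.Fubini_integral[OF intD, symmetric])
    also have "\<dots> = (LINT x|haar. (p (- s + x) * cnj (q x)) * coefficient \<xi> \<eta> s)"
    proof (rule Bochner_Integration.integral_cong[OF refl])
      fix x
      have "(LINT z|haar. D s z x) = (LINT z|haar. (p (- s + x) * cnj (q x)) * (a (- s + (x + z)) * cnj (b (x + z))))"
        by (simp add: D_def add.assoc mult_ac)
      also have "\<dots> = (p (- s + x) * cnj (q x)) * (LINT z|haar. a (- s + (x + z)) * cnj (b (x + z)))"
        by simp
      also have "(LINT z|haar. a (- s + (x + z)) * cnj (b (x + z))) = (LINT z|haar. a (- s + z) * cnj (b z))"
        by (rule integral_haar_translate[of "\<lambda>y. a (- s + y) * cnj (b y)" x]) measurable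
      finally show "(LINT z|haar. D s z x) = p (- s + x) * cnj (q x) * coefficient \<xi> \<eta> s"
        by (simp add: a b coefficient_abs)
    qed
    also have "\<dots> = coefficient \<xi>' \<eta>' s * coefficient \<xi> \<eta> s"
      by (simp add: p q coefficient_abs)
    finally show ?thesis .
  qed
  define H where "H s z = (LINT x|haar. f s * D s z x)" for s z
  \<comment> \<open>Since \<open>B\<close> is independent of \<open>s\<close>, the integrability of
    \<open>f\<close> carries over to all three variables. Pairing \<open>s\<close> with
    \<open>z\<close> lets \<open>x\<close> be integrated out first, leaving \<open>H\<close> on the
    product, where \<open>s\<close> and \<open>z\<close> can be exchanged.\<close>
  have "integrable ((haar \<Otimes>\<^sub>M haar) \<Otimes>\<^sub>M haar) (\<lambda>(w, x). f (fst w) * D (fst w) (snd w) x)"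
  proof (rule integrableI_bounded)
    have "(\<integral>\<^sup>+w. ennreal (norm (case w of (w, x) \<Rightarrow> f (fst w) * D (fst w) (snd w) x)) \<partial>((haar \<Otimes>\<^sub>M haar) \<Otimes>\<^sub>M haar))
      = (\<integral>\<^sup>+w. \<integral>\<^sup>+x. ennreal (norm (f (fst w) * D (fst w) (snd w) x)) \<partial>haar \<partial>(haar \<Otimes>\<^sub>M haar))"
      by (subst nn_integral_fst[symmetric]) simp_all
    also have "\<dots> = (\<integral>\<^sup>+s. \<integral>\<^sup>+z. \<integral>\<^sup>+x. ennreal (norm (f s * D s z x)) \<partial>haar \<partial>haar \<partial>haar)"
      by (subst nn_integral_fst[symmetric]) simp_all
    also have "\<dots> = (\<integral>\<^sup>+s. ennreal (cmod (f s)) * (\<integral>\<^sup>+z. \<integral>\<^sup>+x. ennreal (cmod (D s z x)) \<partial>haar \<partial>haar) \<partial>haar)"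
      by (simp add: norm_mult ennreal_mult nn_integral_cmult)
    also have "\<dots> \<le> (\<integral>\<^sup>+s. ennreal (cmod (f s)) * ennreal B \<partial>haar)"
      by (intro nn_integral_mono mult_left_mono D_bound) simp
    also have "\<dots> = (\<integral>\<^sup>+s. ennreal (cmod (f s)) \<partial>haar) * ennreal B"
      by (rule nn_integral_multc) measurable
    also have "\<dots> < \<infinity>"
      using f by (simp add: integrable_iff_bounded ennreal_mult_less_top)
    finally show "(\<integral>\<^sup>+w. ennreal (norm (case w of (w, x) \<Rightarrow> f (fst w) * D (fst w) (snd w) x))
        \<partial>((haar \<Otimes>\<^sub>M haar) \<Otimes>\<^sub>M haar)) < \<infinity>" .
  qed measurable
  from PP.integrable_fst[OF this]
  have intH: "integrable (haar \<Otimes>\<^sub>M haar) (\<lambda>(s, z). H s z)"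
    by (simp add: H_def split_def)
  define h where "h z = (LINT s|haar. H s z)" for z
  have inth: "integrable haar h"
    unfolding h_def by (rule P.integrable_snd[OF intH])
  have "(LINT s|haar. f s * coefficient \<xi>' \<eta>' s * coefficient \<xi> \<eta> s) = (LINT s|haar. LINT z|haar. H s z)"
    by (simp add: H_def D_eq mult.assoc)
  also have "\<dots> = (LINT z|haar. h z)"
    unfolding h_def by (rule P.Fubini_integral[OF intH, symmetric])
  finally have eq: "(LINT s|haar. f s * coefficient \<xi>' \<eta>' s * coefficient \<xi> \<eta> s) = (LINT z|haar. h z)" .
  define N where "N p a z = (\<integral>\<^sup>+x. ennreal ((cmod (p (0 + x) * a (0 + x + z)))\<^sup>2) \<partial>haar)"
    for p a :: "'g \<Rightarrow> complex" and z
  have [measurable]: "N p a \<in> borel_measurable borel" "N q b \<in> borel_measurable borel"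
    unfolding N_def by measurable
  \<comment> \<open>For almost every \<open>z\<close> the slices are vectors, and \<open>h z\<close>
    is the inner product of \<open>T\<close> applied to one with the other. Their squared norms
    \<open>N p a z\<close> and \<open>N q b z\<close> integrate to the two summands of
    \<open>B\<close>.\<close>
  have "AE z in haar. ennreal (cmod (h z)) \<le> ennreal (norm T) * (N p a z + N q b z)"
    using AE_square_integrable_twist[OF p(1) a(1)] AE_square_integrable_twist[OF q(1) b(1)]
  proof eventually_elim
    case (elim z)
    define x where "x = abs_L2 (\<lambda>x. p x * a (x + z))"
    define y where "y = abs_L2 (\<lambda>x. q x * b (x + z))"
    have "H s z = f s * coefficient x y s" for s
      unfolding x_def y_def coefficient_abs[OF elim] H_def D_def by simp
    then have "h z = cinner (blinfun_apply T x) y"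
      by (simp add: h_def T_def cinner_left_regular_L1[OF f])
    then have "cmod (h z) \<le> norm (blinfun_apply T x) * norm y"
      by (simp add: cinner_Cauchy_Schwarz)
    also have "\<dots> \<le> (norm T * norm x) * norm y"
      by (intro mult_right_mono norm_blinfun) simp
    also have "\<dots> = norm T * (norm x * norm y)" by simp
    also have "norm x * norm y \<le> (norm x)\<^sup>2 + (norm y)\<^sup>2"
      by (rule mult_le_sum_squares)
    finally have "cmod (h z) \<le> norm T * ((norm x)\<^sup>2 + (norm y)\<^sup>2)"
      by (simp add: mult_left_mono)
    then have "ennreal (cmod (h z)) \<le> ennreal (norm T * ((norm x)\<^sup>2 + (norm y)\<^sup>2))"
      by (rule ennreal_leI)
    also have "\<dots> = ennreal (norm T) * (N p a z + N q b z)"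
      using nn_integral_square_eq[OF elim(1)] nn_integral_square_eq[OF elim(2)]
      by (simp add: x_def y_def N_def ennreal_mult)
    finally show ?case .
  qed
  then have "(\<integral>\<^sup>+z. ennreal (cmod (h z)) \<partial>haar) \<le> (\<integral>\<^sup>+z. ennreal (norm T) * (N p a z + N q b z) \<partial>haar)"
    by (rule nn_integral_mono_AE)
  also have "\<dots> = ennreal (norm T) * ((\<integral>\<^sup>+z. N p a z \<partial>haar) + (\<integral>\<^sup>+z. N q b z \<partial>haar))"
    by (simp add: nn_integral_cmult nn_integral_add)
  also have "\<dots> = ennreal (norm T * B)"
    unfolding N_def nn_integral_twist[OF p(1) a(1)] nn_integral_twist[OF q(1) b(1)]
    by (simp add: B_def p q a b ennreal_mult)
  finally have "ennreal (cmod (LINT z|haar. h z)) \<le> ennreal (norm T * B)"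
    using integral_norm_bound_ennreal[OF inth] by (rule order_trans[rotated])
  then have "cmod (LINT z|haar. h z) \<le> norm T * B"
    by (simp add: B_def)
  then show ?thesis
    unfolding eq T_def B_def .
qed

text \<open>The constant depends on the coefficient alone and not on \<open>f\<close>, so
  multiplication of \<open>f\<close> by a coefficient passes to operator norm limits.\<close>

lemma norm_left_regular_L1_mult_coefficient:
  fixes f :: "'g::{haar_group, second_countable_topology} \<Rightarrow> complex"
  assumes f: "integrable haar f"
  shows "norm (left_regular_L1 (\<lambda>s. f s * coefficient \<xi>' \<eta>' s))
    \<le> ((norm \<xi>')\<^sup>2 + (norm \<eta>')\<^sup>2) * norm (left_regular_L1 f)"
proof (rule norm_blinfun_bound)
  fix \<xi> :: "'g L2"
  define S where "S = left_regular_L1 (\<lambda>s. f s * coefficient \<xi>' \<eta>' s)"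
  define \<zeta> where "\<zeta> = blinfun_apply S \<xi>"
  have "norm \<zeta> \<le> ((norm \<xi>')\<^sup>2 + (norm \<eta>')\<^sup>2) * norm (left_regular_L1 f) * norm \<xi>"
  proof (cases "\<zeta> = 0")
    case False
    then have "\<xi> \<noteq> 0" by (auto simp: \<zeta>_def)
    \<comment> \<open>Rescaling the test vector to the norm of \<xi> turns the sum-of-squares bound
      into a multiple of the square of \<open>norm \<xi>\<close>, one factor of which
      cancels.\<close>
    define \<eta> where "\<eta> = (norm \<xi> / norm \<zeta>) *\<^sub>R \<zeta>"
    have \<eta>: "norm \<eta> = norm \<xi>" using False by (simp add: \<eta>_def)
    have "cinner \<zeta> \<eta> = (LINT s|haar. f s * coefficient \<xi>' \<eta>' s * coefficient \<xi> \<eta> s)"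
      unfolding \<zeta>_def S_def by (rule cinner_left_regular_L1[OF integrable_mult_coefficient[OF f]])
    then have "cmod (cinner \<zeta> \<eta>) \<le> norm (left_regular_L1 f) * ((norm \<xi>' * norm \<xi>)\<^sup>2 + (norm \<eta>' * norm \<eta>)\<^sup>2)"
      using integral_coefficient_product_bound[OF f] by simp
    also have "\<dots> = ((norm \<xi>')\<^sup>2 + (norm \<eta>')\<^sup>2) * norm (left_regular_L1 f) * norm \<xi> * norm \<xi>"
      by (simp add: \<eta> power2_eq_square algebra_simps)
    finally have "cmod (cinner \<zeta> \<eta>) \<le> ((norm \<xi>')\<^sup>2 + (norm \<eta>')\<^sup>2) * norm (left_regular_L1 f) * norm \<xi> * norm \<xi>" .
    moreover have "cmod (cinner \<zeta> \<eta>) = norm \<zeta> * norm \<xi>"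
      using False by (simp add: \<eta>_def cinner_self norm_mult norm_divide norm_power power2_eq_square)
    ultimately show ?thesis
      using \<open>\<xi> \<noteq> 0\<close> by (simp add: mult_le_cancel_right)
  qed simp
  then show "norm (blinfun_apply (left_regular_L1 (\<lambda>s. f s * coefficient \<xi>' \<eta>' s)) \<xi>)
      \<le> ((norm \<xi>')\<^sup>2 + (norm \<eta>')\<^sup>2) * norm (left_regular_L1 f) * norm \<xi>"
    by (simp add: \<zeta>_def S_def)
qed simp

section \<open>The module action of A(G) on the reduced C*-algebra\<close>

lemma reduced_CstarE:
  fixes T :: "'g::haar_group L2 \<Rightarrow>\<^sub>L 'g L2"
  assumes "T \<in> reduced_Cstar"
  obtains f where "\<And>n. integrable haar (f n)" "(\<lambda>n. left_regular_L1 (f n)) \<longlonglongrightarrow> T"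
proof -
  obtain X where X: "\<And>n. X n \<in> left_regular_L1 ` {f. integrable haar f}" "X \<longlonglongrightarrow> T"
    using assms unfolding reduced_Cstar_def closure_sequential by blast
  then have "\<forall>n. \<exists>f. integrable haar f \<and> X n = left_regular_L1 f" by blast
  then obtain f where f: "\<And>n. integrable haar (f n)" "\<And>n. X n = left_regular_L1 (f n)"
    by metis
  have "X = (\<lambda>n. left_regular_L1 (f n))" using f(2) by blast
  then show ?thesis using that[of f] f(1) X(2) by simp
qed

lemma tendsto_cinner_apply:
  assumes "X \<longlonglongrightarrow> T"
  shows "(\<lambda>n. cinner (blinfun_apply (X n) \<xi>) \<eta>) \<longlonglongrightarrow> cinner (blinfun_apply T \<xi>) \<eta>"
  by (intro bounded_bilinear.tendsto[OF bounded_bilinear_cinner] tendsto_intros assms)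

lemma reduced_Cstar_subset_bounded_ops:
  "reduced_Cstar \<subseteq> (bounded_ops :: ('g::{haar_group, second_countable_topology} L2 \<Rightarrow>\<^sub>L 'g L2) set)"
proof
  fix T :: "'g L2 \<Rightarrow>\<^sub>L 'g L2" assume "T \<in> reduced_Cstar"
  then obtain f where f: "\<And>n. integrable haar (f n)" "(\<lambda>n. left_regular_L1 (f n)) \<longlonglongrightarrow> T"
    by (rule reduced_CstarE) (rule that)
  have "blinfun_apply T (scaleC c x) = scaleC c (blinfun_apply T x)" for c x
  proof (rule cinner_eqI)
    fix z
    have "(\<lambda>n. cinner (blinfun_apply (left_regular_L1 (f n)) (scaleC c x)) z)
        \<longlonglongrightarrow> cinner (blinfun_apply T (scaleC c x)) z"
      by (rule tendsto_cinner_apply[OF f(2)])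
    moreover have "(\<lambda>n. cinner (blinfun_apply (left_regular_L1 (f n)) (scaleC c x)) z)
        \<longlonglongrightarrow> c * cinner (blinfun_apply T x) z"
      using left_regular_L1_bounded_ops[OF f(1)]
      by (simp add: bounded_ops_def tendsto_mult_left[OF tendsto_cinner_apply[OF f(2)]])
    ultimately show "cinner (blinfun_apply T (scaleC c x)) z = cinner (scaleC c (blinfun_apply T x)) z"
      using LIMSEQ_unique by simp
  qed
  then show "T \<in> bounded_ops" by (simp add: bounded_ops_def)
qed

section \<open>Inclusion in VN(G) and the pairing with A(G)\<close>

lemma reduced_Cstar_subset_VN:
  "reduced_Cstar \<subseteq> (VN :: ('g::{haar_group, second_countable_topology} L2 \<Rightarrow>\<^sub>L 'g L2) set)"
  unfolding VN_def
proof (rule closure_of_subset)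
  have "(bounded_ops :: ('g L2 \<Rightarrow>\<^sub>L 'g L2) set) \<subseteq> topspace weak_star_topology"
    unfolding weak_star_topology_def topology_generated_by_topspace
  proof (rule Union_upper, rule CollectI)
    show "\<exists>\<xi> \<eta> U. (bounded_ops :: ('g L2 \<Rightarrow>\<^sub>L 'g L2) set)
        = {T \<in> bounded_ops. (\<Sum>n. cinner (blinfun_apply T (\<xi> n)) (\<eta> n)) \<in> U} \<and>
        summable (\<lambda>n::nat. (norm (\<xi> n))\<^sup>2) \<and> summable (\<lambda>n::nat. (norm (\<eta> n))\<^sup>2) \<and> open U"
      \<comment> \<open>Zero sequences and \<open>U = UNIV\<close> exhibit
        \<open>bounded_ops\<close> itself as a subbasic open set, hence as part of the carrier of
        the topology.\<close>
      by (rule exI[of _ "\<lambda>_. 0"], rule exI[of _ "\<lambda>_. 0"], rule exI[of _ UNIV]) simp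
  qed
  then show "(reduced_Cstar :: ('g L2 \<Rightarrow>\<^sub>L 'g L2) set) \<subseteq> topspace weak_star_topology"
    using reduced_Cstar_subset_bounded_ops by (rule order_trans[rotated])
qed

text \<open>For the operator of an integrable \<open>f\<close> the value is the integral of
  \<open>f\<close> against the coefficient function, which does not see the vectors; norm limits
  preserve this. So \<open>pairing\<close> is well defined on the reduced C*-algebra.\<close>

lemma cinner_apply_eq_of_coefficient_eq:
  fixes T :: "'g::{haar_group, second_countable_topology} L2 \<Rightarrow>\<^sub>L 'g L2"
  assumes "T \<in> reduced_Cstar" "coefficient \<xi> \<eta> = coefficient \<xi>' \<eta>'"
  shows "cinner (blinfun_apply T \<xi>) \<eta> = cinner (blinfun_apply T \<xi>') \<eta>'"
proof -
  obtain f where f: "\<And>n. integrable haar (f n)" "(\<lambda>n. left_regular_L1 (f n)) \<longlonglongrightarrow> T"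
    using assms(1) by (rule reduced_CstarE) (rule that)
  have "cinner (blinfun_apply (left_regular_L1 (f n)) \<xi>) \<eta>
      = cinner (blinfun_apply (left_regular_L1 (f n)) \<xi>') \<eta>'" for n
    using assms(2) by (simp add: cinner_left_regular_L1[OF f(1)])
  then show ?thesis
    using tendsto_cinner_apply[OF f(2), of \<xi> \<eta>] tendsto_cinner_apply[OF f(2), of \<xi>' \<eta>']
    by (simp add: LIMSEQ_unique)
qed

lemma pairing_coefficient:
  fixes T :: "'g::{haar_group, second_countable_topology} L2 \<Rightarrow>\<^sub>L 'g L2"
  assumes "T \<in> reduced_Cstar"
  shows "pairing (coefficient \<xi> \<eta>) T = cinner (blinfun_apply T \<xi>) \<eta>"
  unfolding pairing_def
proof (rule the_equality)
  show "\<forall>\<xi>' \<eta>'. coefficient \<xi> \<eta> = coefficient \<xi>' \<eta>'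
      \<longrightarrow> cinner (blinfun_apply T \<xi>) \<eta> = cinner (blinfun_apply T \<xi>') \<eta>'"
    by (intro allI impI cinner_apply_eq_of_coefficient_eq[OF assms])
qed blast

lemma pairing_0:
  fixes u :: "'g::haar_group \<Rightarrow> complex"
  assumes "u \<in> fourier_algebra" shows "pairing u 0 = 0"
proof -
  obtain \<xi> \<eta> where "u = coefficient \<xi> \<eta>"
    using assms unfolding fourier_algebra_def by blast
  then show ?thesis
    unfolding pairing_def
    by (intro the_equality, simp) (metis blinfun.zero_left cinner_zero_left)
qed

text \<open>The operator \<open>S\<close> is the module product of \<open>u\<close> and
  \<open>T\<close>: the limit of the operators of \<open>f n\<close> times \<open>u\<close>, which
  are Cauchy by the norm bound for multiplication by a coefficient. The premise on the product
  supplies vectors representing it, through which its pairing with \<open>T\<close> is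
  computed.\<close>

lemma reduced_Cstar_module:
  fixes T :: "'g::{haar_group, second_countable_topology} L2 \<Rightarrow>\<^sub>L 'g L2"
  assumes T: "T \<in> reduced_Cstar" and u: "u \<in> fourier_algebra"
  shows "\<exists>S\<in>reduced_Cstar. \<forall>v\<in>fourier_algebra.
    (\<lambda>s. u s * v s) \<in> fourier_algebra \<longrightarrow> pairing v S = pairing (\<lambda>s. u s * v s) T"
proof -
  obtain \<xi>' \<eta>' where u_eq: "u = coefficient \<xi>' \<eta>'"
    using u unfolding fourier_algebra_def by blast
  obtain f where f: "\<And>n. integrable haar (f n)" "(\<lambda>n. left_regular_L1 (f n)) \<longlonglongrightarrow> T"
    using T by (rule reduced_CstarE) (rule that)
  \<comment> \<open>The summand 1 makes \<open>C\<close> strictly positive, so that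
    \<open>e / C\<close> can be used in the Cauchy argument.\<close>
  define C where "C = (norm \<xi>')\<^sup>2 + (norm \<eta>')\<^sup>2 + 1"
  have "C > 0" by (simp add: C_def add_nonneg_pos)
  define S where "S n = left_regular_L1 (\<lambda>s. f n s * u s)" for n
  have fu: "integrable haar (\<lambda>s. f n s * u s)" for n
    unfolding u_eq by (rule integrable_mult_coefficient[OF f(1)])
  have S_le: "norm (S m - S n) \<le> C * norm (left_regular_L1 (f m) - left_regular_L1 (f n))" for m n
  proof -
    have "S m - S n = left_regular_L1 (\<lambda>s. (f m s - f n s) * u s)"
      unfolding S_def left_regular_L1_diff[OF fu fu, symmetric] by (simp add: left_diff_distrib)
    then have "norm (S m - S n) \<le> ((norm \<xi>')\<^sup>2 + (norm \<eta>')\<^sup>2) * norm (left_regular_L1 (\<lambda>s. f m s - f n s))"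
      unfolding u_eq using f(1) by (simp add: norm_left_regular_L1_mult_coefficient)
    also have "\<dots> \<le> C * norm (left_regular_L1 (\<lambda>s. f m s - f n s))"
      by (intro mult_right_mono) (auto simp: C_def)
    finally show ?thesis by (simp add: left_regular_L1_diff f(1))
  qed
  have "Cauchy S"
  proof (rule CauchyI)
    fix e :: real assume "e > 0"
    then have "e / C > 0" using \<open>C > 0\<close> by simp
    then obtain M where M: "\<forall>m\<ge>M. \<forall>n\<ge>M. norm (left_regular_L1 (f m) - left_regular_L1 (f n)) < e / C"
      using LIMSEQ_imp_Cauchy[OF f(2)] unfolding Cauchy_iff by blast
    have "norm (S m - S n) < e" if "m \<ge> M" "n \<ge> M" for m n
    proof -
      have "C * norm (left_regular_L1 (f m) - left_regular_L1 (f n)) < e"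
        using M that \<open>C > 0\<close> by (simp add: pos_less_divide_eq mult.commute)
      then show ?thesis using S_le[of m n] by linarith
    qed
    then show "\<exists>M. \<forall>m\<ge>M. \<forall>n\<ge>M. norm (S m - S n) < e" by blast
  qed
  then obtain R where R: "S \<longlonglongrightarrow> R"
    using Cauchy_convergent convergent_def by blast
  have R_mem: "R \<in> reduced_Cstar"
    unfolding reduced_Cstar_def closure_sequential
    using fu R by (intro exI[of _ S]) (auto simp: S_def)
  show ?thesis
  proof (intro bexI[OF _ R_mem] ballI impI)
    fix v assume "v \<in> fourier_algebra" "(\<lambda>s. u s * v s) \<in> fourier_algebra"
    then obtain \<xi> \<eta> \<alpha> \<beta> where v: "v = coefficient \<xi> \<eta>" and uv: "(\<lambda>s. u s * v s) = coefficient \<alpha> \<beta>"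
      unfolding fourier_algebra_def by blast
    \<comment> \<open>Both sides are the integral of \<open>f n\<close> times \<open>u\<close> times
      \<open>v\<close>.\<close>
    have "cinner (blinfun_apply (S n) \<xi>) \<eta> = cinner (blinfun_apply (left_regular_L1 (f n)) \<alpha>) \<beta>" for n
      unfolding S_def cinner_left_regular_L1[OF fu] cinner_left_regular_L1[OF f(1)]
      by (simp add: uv[symmetric] v[symmetric] mult.assoc)
    then have "cinner (blinfun_apply R \<xi>) \<eta> = cinner (blinfun_apply T \<alpha>) \<beta>"
      using tendsto_cinner_apply[OF R, of \<xi> \<eta>] tendsto_cinner_apply[OF f(2), of \<alpha> \<beta>]
      by (simp add: LIMSEQ_unique)
    then show "pairing v R = pairing (\<lambda>s. u s * v s) T"
      by (simp add: v[symmetric] uv pairing_coefficient[OF R_mem, of \<xi> \<eta>, folded v] pairing_coefficient[OF T])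
  qed
qed

section \<open>Local units of A(G) and compactly supported vectors\<close>

lemma square_integrable_indicator:
  fixes K :: "'g::haar_group set"
  assumes "compact K" shows "square_integrable (indicator K :: 'g \<Rightarrow> complex)"
proof -
  have K: "K \<in> sets borel" using assms by (rule sets_borel_compact)
  have "(\<lambda>x. (cmod (indicator K x))\<^sup>2) = (indicator K :: 'g \<Rightarrow> real)"
    by (auto simp: indicator_def)
  then show ?thesis
    using K emeasure_haar_compact[OF assms] by (simp add: square_integrable_def)
qed

lemma square_integrable_restrict:
  assumes "square_integrable f" "K \<in> sets borel"
  shows "square_integrable (\<lambda>x. indicator K x * f x)"
proof -
  have [measurable]: "f \<in> borel_measurable borel"
    using assms by (auto intro: square_integrable_measurable)
  have [measurable]: "K \<in> sets borel" by fact
  have "integrable haar (\<lambda>x. (cmod (f x))\<^sup>2)"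
    using assms by (simp add: square_integrable_def)
  then have "integrable haar (\<lambda>x. (cmod (indicator K x * f x))\<^sup>2)"
    by (rule Bochner_Integration.integrable_bound) (auto simp: indicator_def)
  then show ?thesis by (simp add: square_integrable_def)
qed

text \<open>Take the coefficient of the normalized indicator of a compact \<open>W\<close> of
  positive measure and the indicator of the product set \<open>L\<close> of \<open>K\<close> and
  \<open>W\<close>. For \<open>s\<close> in \<open>K\<close> the translate of \<open>W\<close> by
  \<open>s\<close> lies in \<open>L\<close>, so the inner product is the full integral 1.\<close>

lemma fourier_algebra_eq_1_on_compact:
  fixes K :: "'g::haar_group set"
  assumes K: "compact K"
  shows "\<exists>v\<in>fourier_algebra. \<forall>s\<in>K. v s = 1"
proof -
  have "emeasure haar (UNIV :: 'g set) \<noteq> 0"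
    using left_haar_measure_haar[where 'a='g] unfolding left_haar_measure_def by (elim conjE)
  moreover have "\<forall>U :: 'g set. open U \<longrightarrow> emeasure haar U = (SUP K\<in>{K. compact K \<and> K \<subseteq> U}. emeasure haar K)"
    using left_haar_measure_haar[where 'a='g] unfolding left_haar_measure_def by (elim conjE)
  \<comment> \<open>Inner regularity of the open set \<open>UNIV\<close>, whose measure is nonzero,
    produces the compact set \<open>W\<close> of positive measure.\<close>
  ultimately have "(SUP K\<in>{K :: 'g set. compact K \<and> K \<subseteq> UNIV}. emeasure haar K) \<noteq> 0"
    by (metis open_UNIV)
  then obtain W :: "'g set" where W: "compact W" "emeasure haar W \<noteq> 0"
    by (auto simp: SUP_eq_iff bot_ennreal[symmetric] simp del: bot_ennreal)
  define m where "m = measure (haar :: 'g measure) W"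
  have fin: "emeasure haar W \<noteq> \<infinity>"
    using emeasure_haar_compact[OF W(1)] by simp
  then have "m \<noteq> 0"
    using W(2) by (simp add: m_def measure_def enn2real_eq_0_iff)
  define L where "L = (\<lambda>(x, y). x + y) ` (K \<times> W)"
  have L: "compact L"
    unfolding L_def split_def
    by (intro compact_continuous_image compact_Times K W(1) continuous_intros)
  have W_borel: "W \<in> sets borel" using W(1) by (rule sets_borel_compact)
  define w where "w x = complex_of_real (1 / m) * indicator W x" for x
  have w: "square_integrable w"
    unfolding w_def by (intro square_integrable_scale square_integrable_indicator W(1))
  have "coefficient (abs_L2 w) (abs_L2 (indicator L)) s = 1" if "s \<in> K" for s
  proof -
    have "w (- s + t) * cnj (indicator L t) = w (- s + t)" for t
    proof (cases "- s + t \<in> W")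
      case True
      then have "s + (- s + t) \<in> L" using that unfolding L_def by blast
      then show ?thesis by (simp add: add.assoc[symmetric])
    qed (simp add: w_def)
    then have "coefficient (abs_L2 w) (abs_L2 (indicator L)) s = (LINT t|haar. w (- s + t))"
      unfolding coefficient_abs[OF w square_integrable_indicator[OF L]]
      by (intro Bochner_Integration.integral_cong refl)
    also have "\<dots> = (LINT t|haar. w t)"
      using w by (intro integral_haar_translate square_integrable_measurable)
    also have "\<dots> = 1"
    proof -
      have "w = (\<lambda>x. complex_of_real (1 / m * indicator W x))"
        by (auto simp: w_def indicator_def)
      then have "(LINT t|haar. w t) = complex_of_real (LINT t|haar. 1 / m * indicator W t)"
        by (simp only: integral_complex_of_real)
      also have "(LINT t|haar. 1 / m * indicator W t) = 1"
        using \<open>m \<noteq> 0\<close> fin W_borel by (simp add: m_def less_top)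
      finally show ?thesis by simp
    qed
    finally show ?thesis .
  qed
  then show ?thesis
    unfolding fourier_algebra_def by blast
qed

text \<open>A nonzero integrand at \<open>t\<close> forces both \<open>t\<close> and
  \<open>- s + t\<close> into \<open>C\<close>, and \<open>s\<close> is the difference
  \<open>t - (- s + t)\<close>. For compact \<open>C\<close> this confines the support to a compact
  set.\<close>

lemma coefficient_support:
  fixes C :: "'g::haar_group set"
  assumes a: "square_integrable a" and b: "square_integrable b" and C: "C \<in> sets borel"
    and nz: "coefficient (abs_L2 (\<lambda>x. indicator C x * a x)) (abs_L2 (\<lambda>x. indicator C x * b x)) s \<noteq> 0"
  shows "s \<in> (\<lambda>(x, y). x - y) ` (C \<times> C)"
proof (rule ccontr)
  assume s: "\<not> ?thesis"
  have "indicator C (- s + t) * a (- s + t) * cnj (indicator C t * b t) = 0" for t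
  proof -
    have "s = t - (- s + t)"
      using add.assoc[of t "- t" s] by (simp add: diff_conv_add_uminus minus_add del: add_uminus_conv_diff)
    then have "\<not> (t \<in> C \<and> - s + t \<in> C)" using s by force
    then show ?thesis by auto
  qed
  then have "(LINT t|haar. indicator C (- s + t) * a (- s + t) * cnj (indicator C t * b t)) = 0"
    by (subst Bochner_Integration.integral_cong[OF refl, where g = "\<lambda>_. 0"]) simp_all
  then show False
    using nz by (simp add: coefficient_abs square_integrable_restrict[OF a C] square_integrable_restrict[OF b C])
qed

text \<open>At each point the truncation error is eventually 0, and its squared modulus is dominated
  by that of \<open>a\<close>; dominated convergence gives norm convergence.\<close>

lemma restrict_tendsto:
  fixes a :: "'g::haar_group \<Rightarrow> complex"
  assumes a: "square_integrable a" and C: "\<And>n. C n \<in> sets borel" "incseq C" "(\<Union>n. C n) = UNIV"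
  shows "(\<lambda>n. abs_L2 (\<lambda>x. indicator (C n) x * a x)) \<longlonglongrightarrow> abs_L2 a"
proof -
  have [measurable]: "a \<in> borel_measurable borel"
    using a by (rule square_integrable_measurable)
  have [measurable]: "C n \<in> sets borel" for n by (rule C(1))
  have "(\<lambda>n. LINT x|haar. (cmod (indicator (C n) x * a x - a x))\<^sup>2) \<longlonglongrightarrow> (LINT x|(haar :: 'g measure). 0)"
  proof (rule integral_dominated_convergence)
    show "integrable haar (\<lambda>x. (cmod (a x))\<^sup>2)" using a by (simp add: square_integrable_def)
    show "AE x in haar. (\<lambda>n. (cmod (indicator (C n) x * a x - a x))\<^sup>2) \<longlonglongrightarrow> 0"
    proof (rule AE_I2)
      fix x :: 'g
      obtain N where "x \<in> C N" using C(3) by auto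
      then have "\<forall>n\<ge>N. x \<in> C n" using C(2) by (auto simp: incseq_def)
      then have "\<forall>\<^sub>F n in sequentially. (cmod (indicator (C n) x * a x - a x))\<^sup>2 = 0"
        unfolding eventually_sequentially by (intro exI[of _ N]) auto
      then show "(\<lambda>n. (cmod (indicator (C n) x * a x - a x))\<^sup>2) \<longlonglongrightarrow> 0"
        by (rule tendsto_eventually)
    qed
    show "AE x in haar. norm ((cmod (indicator (C n) x * a x - a x))\<^sup>2) \<le> (cmod (a x))\<^sup>2" for n
      by (rule AE_I2) (auto simp: indicator_def)
  qed measurable
  then have "(\<lambda>n. (norm (abs_L2 (\<lambda>x. indicator (C n) x * a x) - abs_L2 a))\<^sup>2) \<longlonglongrightarrow> 0"
    using square_integrable_restrict[OF a C(1)] a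
    by (simp add: minus_abs norm_abs_L2 square_integrable_diff)
  then have "(\<lambda>n. sqrt ((norm (abs_L2 (\<lambda>x. indicator (C n) x * a x) - abs_L2 a))\<^sup>2)) \<longlonglongrightarrow> sqrt 0"
    by (rule tendsto_real_sqrt)
  then show ?thesis
    by (simp add: tendsto_norm_zero_iff LIM_zero_iff)
qed

text \<open>Local units replace a global unit: for truncated vectors the product with a suitable
  \<open>v\<close> gives back \<open>u\<close>, which also puts it in A(G) as \<open>ann\<close>
  demands. Truncations approximate all vectors.\<close>

lemma eq_0_if_pairing_product_eq_0:
  fixes T :: "'g::{haar_group, second_countable_topology} L2 \<Rightarrow>\<^sub>L 'g L2"
  assumes T: "T \<in> reduced_Cstar"
    and ann: "\<And>u v. u \<in> fourier_algebra \<Longrightarrow> v \<in> fourier_algebra \<Longrightarrow>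
      (\<lambda>s. v s * u s) \<in> fourier_algebra \<Longrightarrow> pairing (\<lambda>s. v s * u s) T = 0"
  shows "T = 0"
proof (rule blinfun_L2_ext)
  fix \<xi> \<eta> :: "'g L2"
  obtain a where a: "square_integrable a" "\<xi> = abs_L2 a" by (rule L2_cases)
  obtain b where b: "square_integrable b" "\<eta> = abs_L2 b" by (rule L2_cases)
  obtain C :: "nat \<Rightarrow> 'g set" where C: "\<And>n. compact (C n)" "incseq C" "(\<Union>n. C n) = UNIV"
    by (rule compact_exhaustion) (rule that)
  have Cb: "C n \<in> sets borel" for n using C(1) by (rule sets_borel_compact)
  define x where "x n = abs_L2 (\<lambda>t. indicator (C n) t * a t)" for n
  define y where "y n = abs_L2 (\<lambda>t. indicator (C n) t * b t)" for n
  have zero: "cinner (blinfun_apply T (x n)) (y n) = 0" for n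
  proof -
    define u where "u = coefficient (x n) (y n)"
    have u: "u \<in> fourier_algebra" unfolding u_def fourier_algebra_def by blast
    have "compact ((\<lambda>(x, y). x - y) ` (C n \<times> C n))"
      unfolding split_def by (intro compact_continuous_image compact_Times C continuous_intros)
    then obtain v where v: "v \<in> fourier_algebra" "\<forall>s\<in>(\<lambda>(x, y). x - y) ` (C n \<times> C n). v s = 1"
      using fourier_algebra_eq_1_on_compact by blast
    have "v s * u s = u s" for s
    proof (cases "u s = 0")
      case False
      then have "s \<in> (\<lambda>(x, y). x - y) ` (C n \<times> C n)"
        unfolding u_def x_def y_def by (rule coefficient_support[OF a(1) b(1) Cb])
      then have "v s = 1" using v(2) by (rule bspec[rotated])
      then show ?thesis by simp
    qed simp
    then have "(\<lambda>s. v s * u s) = u" by (rule ext)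
    then have "pairing u T = 0" using ann[OF u v(1)] u by simp
    then show ?thesis by (simp add: u_def pairing_coefficient[OF T])
  qed
  have "(\<lambda>n. cinner (blinfun_apply T (x n)) (y n)) \<longlonglongrightarrow> cinner (blinfun_apply T \<xi>) \<eta>"
    unfolding x_def y_def a(2) b(2)
    by (intro bounded_bilinear.tendsto[OF bounded_bilinear_cinner] tendsto_intros
        restrict_tendsto a b Cb C)
  then show "cinner (blinfun_apply T \<xi>) \<eta> = cinner (blinfun_apply 0 \<xi>) \<eta>"
    by (simp add: zero LIMSEQ_const_iff)
qed

section \<open>Operators annihilating the intersection of two ideals\<close>

theorem corollary4p5:
  fixes J1 J2 :: "('g::{haar_group, second_countable_topology} \<Rightarrow> complex) set"
  assumes "ideal_of_uniqueness J1" and "ideal_of_uniqueness J2"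
  shows "ideal_of_uniqueness (J1 \<inter> J2)"
proof -
  note J1 = assms(1)[unfolded ideal_of_uniqueness_def]
  note J2 = assms(2)[unfolded ideal_of_uniqueness_def]
  have J1A: "u \<in> fourier_algebra" if "u \<in> J1" for u
    using that J1 by (auto simp: fourier_ideal_def)
  have J2A: "u \<in> fourier_algebra" if "u \<in> J2" for u
    using that J2 by (auto simp: fourier_ideal_def)
  have mult1: "(\<lambda>s. u s * v s) \<in> J1" if "u \<in> fourier_algebra" "v \<in> J1" for u v
    using that J1 by (auto simp: fourier_ideal_def)
  have mult2: "(\<lambda>s. u s * v s) \<in> J2" if "u \<in> fourier_algebra" "v \<in> J2" for u v
    using that J2 by (auto simp: fourier_ideal_def)
  \<comment> \<open>Annihilators are taken inside \<open>VN\<close>; the inclusion of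
    \<open>reduced_Cstar\<close> discharges that membership.\<close>
  have uniq1: "S = 0" if "S \<in> reduced_Cstar" "\<And>u. u \<in> J1 \<Longrightarrow> pairing u S = 0" for S
    using that J1 reduced_Cstar_subset_VN unfolding annihilator_def by blast
  have uniq2: "S = 0" if "S \<in> reduced_Cstar" "\<And>u. u \<in> J2 \<Longrightarrow> pairing u S = 0" for S
    using that J2 reduced_Cstar_subset_VN unfolding annihilator_def by blast
  have "fourier_ideal (J1 \<inter> J2)"
    using J1 J2 unfolding fourier_ideal_def by auto
  moreover have "fourier_closed (J1 \<inter> J2)"
    using J1 J2 unfolding fourier_closed_def by (metis IntE IntI)
  moreover have "annihilator (J1 \<inter> J2) \<inter> reduced_Cstar = {0}"
  proof
    show "{0} \<subseteq> annihilator (J1 \<inter> J2) \<inter> reduced_Cstar"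
      \<comment> \<open>Annihilators reverse inclusions, so 0 passes from the annihilator of
        \<open>J1\<close> to that of the intersection.\<close>
      using J1 unfolding annihilator_def by blast
    show "annihilator (J1 \<inter> J2) \<inter> reduced_Cstar \<subseteq> {0}"
    proof
      fix T assume "T \<in> annihilator (J1 \<inter> J2) \<inter> reduced_Cstar"
      then have T: "T \<in> reduced_Cstar" and ann: "\<And>u. u \<in> J1 \<Longrightarrow> u \<in> J2 \<Longrightarrow> pairing u T = 0"
        by (auto simp: annihilator_def)
      \<comment> \<open>Here \<open>S\<close> is the product of \<open>u\<close> and
        \<open>T\<close>. Against \<open>w\<close> in \<open>J2\<close> it gives the pairing of
        \<open>T\<close> with \<open>u\<close> times \<open>w\<close>, a function in both ideals, so
        uniqueness for \<open>J2\<close> forces \<open>S = 0\<close>.\<close>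
      have step1: "pairing (\<lambda>s. u s * v s) T = 0" if u: "u \<in> J1" and v: "v \<in> fourier_algebra" for u v
      proof -
        obtain S where S: "S \<in> reduced_Cstar" "\<And>v. v \<in> fourier_algebra \<Longrightarrow>
            (\<lambda>s. u s * v s) \<in> fourier_algebra \<Longrightarrow> pairing v S = pairing (\<lambda>s. u s * v s) T"
          using reduced_Cstar_module[OF T J1A[OF u]] by blast
        have "S = 0"
        proof (rule uniq2[OF S(1)])
          fix w assume w: "w \<in> J2"
          have "(\<lambda>s. u s * w s) \<in> J1" using mult1[OF J2A[OF w] u] by (simp add: mult.commute)
          moreover have "(\<lambda>s. u s * w s) \<in> J2" using mult2[OF J1A[OF u] w] .
          ultimately show "pairing w S = 0"
            using S(2)[OF J2A[OF w]] ann J1A by simp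
        qed
        moreover have "(\<lambda>s. u s * v s) \<in> fourier_algebra"
          using J1A[OF mult1[OF v u]] by (simp add: mult.commute)
        ultimately show ?thesis
          using S(2)[OF v] pairing_0[OF v] by simp
      qed
      \<comment> \<open>The roles change: now an arbitrary \<open>v\<close> in A(G) acts on
        \<open>T\<close>, the result annihilates \<open>J1\<close> by \<open>step1\<close>, and
        uniqueness for \<open>J1\<close> makes it vanish.\<close>
      have "T = 0"
      proof (rule eq_0_if_pairing_product_eq_0[OF T])
        fix u v :: "'g \<Rightarrow> complex"
        assume u: "u \<in> fourier_algebra" and v: "v \<in> fourier_algebra"
          and vu: "(\<lambda>s. v s * u s) \<in> fourier_algebra"
        obtain S where S: "S \<in> reduced_Cstar" "\<And>w. w \<in> fourier_algebra \<Longrightarrow>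
            (\<lambda>s. v s * w s) \<in> fourier_algebra \<Longrightarrow> pairing w S = pairing (\<lambda>s. v s * w s) T"
          using reduced_Cstar_module[OF T v] by blast
        have "S = 0"
        proof (rule uniq1[OF S(1)])
          fix w assume w: "w \<in> J1"
          show "pairing w S = 0"
            using S(2)[OF J1A[OF w] J1A[OF mult1[OF v w]]] step1[OF w v] by (simp add: mult.commute)
        qed
        then show "pairing (\<lambda>s. v s * u s) T = 0"
          using S(2)[OF u vu] pairing_0[OF u] by simp
      qed
      then show "T \<in> {0}" by simp
    qed
  qed
  ultimately show ?thesis by (simp add: ideal_of_uniqueness_def)
qed

end
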